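(* Let $f\colon M^m\to\mathbb{R}\times_\rho\mathbb{Q}^n_\epsilon$ be an isometric immersion of a connected Riemannian manifold and assume that $L:=N_1+\operatorname{span}\{\eta\}$ is a subbundle of the normal bundle $TM^\perp_f$ of rank $l<n+1-m$ and that $\nabla^\perp N_1\subset L$. Then $f$ reduces codimension to $l$, i.e. $f(M^m)$ is contained in a totally geodesic submanifold $\mathbb{R}\times_\rho\mathbb{Q}^{m+l-1}_\epsilon$ of $\mathbb{R}\times_\rho\mathbb{Q}^n_\epsilon$.
   Context: $\mathbb{Q}^n_\epsilon$ denotes the unit sphere $\mathbb{S}^n$ if $\epsilon=1$ and the hyperbolic space $\mathbb{H}^n$ (curvature $-1$) if $\epsilon=-1$, realized as $\mathbb{Q}^n_\epsilon=\{x\in\mathbb{E}^{n+1}:\epsilon x_1^2+x_2^2+\dots+x_{n+1}^2=\epsilon\}$ (with $x_1>0$ if $\epsilon=-1$), where $\mathbb{E}^{k}$ is $\mathbb{R}^{k}$ with the flat metric $\epsilon dx_1^2+dx_2^2+\dots+dx_k^2$. Given a smooth positive function $\rho\colon\mathbb{R}\to\mathbb{R}$, the warped product $\mathbb{R}\times_\rho\mathbb{Q}^n_\epsilon$ is the manifold $\mathbb{R}\times\mathbb{Q}^n_\epsilon$ with the metric $\langle\,,\rangle=\pi_1^*dt^2+(\rho\circ\pi_1)^2\pi_2^*\langle\,,\rangle_{\mathbb{Q}^n_\epsilon}$, where $\pi_1,\pi_2$ are the canonical projections; $\partial_t$ is the unit vector field tangent to the factor $\mathbb{R}$. For $k\le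 n$, $\mathbb{R}\times_\rho\mathbb{Q}^k_\epsilon$ denotes the totally geodesic submanifold $\mathbb{R}\times\mathbb{Q}^k_\epsilon$, where $\mathbb{Q}^k_\epsilon\subset\mathbb{Q}^n_\epsilon$ is a totally geodesic submanifold of dimension $k$ obtained by intersecting $\mathbb{Q}^n_\epsilon$ with a linear subspace of $\mathbb{E}^{n+1}$ of dimension $k+1$. Standing assumptions: the ambient space is a rotational hypersurface of $\mathbb{E}^{n+2}$ via $i(t,x)=(\rho(t)x,h(t))$, where $h\colon\mathbb{R}\to\mathbb{R}$ is smooth with $\epsilon\rho'(t)^2+h'(t)^2=1$ and $h'(t)>0$ for all $t$. The ambient space does not have constant sectional curvature, in the sense that the function $(\rho''(t)\rho(t)-\rho'(t)^2+\epsilon)/\rho(t)^2$ is nowhere zero. For an isometric immersion $f\colon M^m\to\mathbb{R}\times_\rho\mathbb{Q}^n_\epsilon$, write $\partial_t=f_*T+\eta$ along $f$, with $T$ tangent to $M$ and $\eta$ normal to $f$. Let $\alpha_f$ be the second fundamental form and $\nabla^\perp$ the normal connection. The first normal space $N_1(x)$ at $x$ is the subspace of the normal space $T_xM^\perp$ spanned by the values of $\alpha_f$ at $x$. The notation $\nabla^\perp N_1\subset L$ means $\nabla^\perp_X\xi\in L$ for every $X\in TM$ and every local smooth section $\xi$ of $TM^\perp_f$ with values in $N_1$. *)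

theory Defs
  imports "HOL-Analysis.Analysis"
begin

subsection \<open>Smooth maps between Euclidean spaces\<close>

text \<open>These are only used for an open set \<open>S\<close> of a finite-dimensional space; the derivative is
  the full one, so that no one-sided derivatives are involved.\<close>

primrec Ck_on :: "nat \<Rightarrow> 'a::real_normed_vector set \<Rightarrow> ('a \<Rightarrow> 'b::real_normed_vector) \<Rightarrow> bool" where
  "Ck_on 0 S f \<longleftrightarrow> continuous_on S f"
| "Ck_on (Suc k) S f \<longleftrightarrow>
     (\<forall>x\<in>S. f differentiable (at x)) \<and> (\<forall>v. Ck_on k S (\<lambda>x. frechet_derivative f (at x) v))"

definition smooth_on :: "'a::real_normed_vector set \<Rightarrow> ('a \<Rightarrow> 'b::real_normed_vector) \<Rightarrow> bool" where
  "smooth_on S f \<longleftrightarrow> (\<forall>k. Ck_on k S f)"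


subsection \<open>Smooth and Riemannian manifolds\<close>

text \<open>A manifold is a Hausdorff, second countable topological space, the universe of the type
  \<open>'a\<close>, with an atlas; a chart is a pair of its domain and the coordinate map.  A tangent vector
  at a point \<open>p\<close> is given by its coordinate vector in a chart around \<open>p\<close>.\<close>

type_synonym ('a, 'm) chart = "'a set \<times> ('a \<Rightarrow> real ^ 'm)"

definition in_chart :: "('a, 'm::finite) chart \<Rightarrow> ('a \<Rightarrow> 'b) \<Rightarrow> (real ^ 'm \<Rightarrow> 'b)" where
  "in_chart c s = s \<circ> inv_into (fst c) (snd c)"

text \<open>The derivative of a vector-valued map at \<open>p\<close> along the tangent vector which has the
  coordinates \<open>u\<close> in the chart \<open>c\<close>.\<close>

definition dir_deriv ::
    "('a, 'm::finite) chart \<Rightarrow> ('a \<Rightarrow> 'b::real_normed_vector) \<Rightarrow> 'a \<Rightarrow> real ^ 'm \<Rightarrow> 'b" where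
  "dir_deriv c s p u = frechet_derivative (in_chart c s) (at (snd c p)) u"

definition smooth_along ::
    "('a, 'm::finite) chart set \<Rightarrow> 'a set \<Rightarrow> ('a \<Rightarrow> 'b::real_normed_vector) \<Rightarrow> bool" where
  "smooth_along A W s \<longleftrightarrow> (\<forall>c\<in>A. smooth_on (snd c ` (fst c \<inter> W)) (in_chart c s))"

definition smooth_atlas :: "('a::topological_space, 'm::finite) chart set \<Rightarrow> bool" where
  "smooth_atlas A \<longleftrightarrow>
     (\<Union>c\<in>A. fst c) = UNIV \<and>
     (\<forall>c\<in>A. open (fst c) \<and> open (snd c ` fst c) \<and>
        homeomorphism (fst c) (snd c ` fst c) (snd c) (inv_into (fst c) (snd c))) \<and>
     (\<forall>c\<in>A. smooth_along A (fst c) (snd c))"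

text \<open>\<open>g c p u v\<close> is the inner product of the tangent vectors at \<open>p\<close> which have the coordinates
  \<open>u\<close> and \<open>v\<close> in the chart \<open>c\<close>; \<open>dir_deriv c (snd c') p\<close> is the change of coordinates of
  tangent vectors at \<open>p\<close> from \<open>c\<close> to \<open>c'\<close>.\<close>

definition riemannian_metric ::
    "('a, 'm::finite) chart set \<Rightarrow> (('a, 'm) chart \<Rightarrow> 'a \<Rightarrow> real ^ 'm \<Rightarrow> real ^ 'm \<Rightarrow> real) \<Rightarrow> bool" where
  "riemannian_metric A g \<longleftrightarrow>
     (\<forall>c\<in>A. \<forall>p\<in>fst c. bilinear (g c p) \<and> (\<forall>u v. g c p u v = g c p v u) \<and>
        (\<forall>u. u \<noteq> 0 \<longrightarrow> g c p u u > 0)) \<and>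
     (\<forall>c\<in>A. \<forall>u v. smooth_on (snd c ` fst c) (in_chart c (\<lambda>p. g c p u v))) \<and>
     (\<forall>c\<in>A. \<forall>c'\<in>A. \<forall>p\<in>fst c \<inter> fst c'. \<forall>u v.
        g c p u v = g c' p (dir_deriv c (snd c') p u) (dir_deriv c (snd c') p v))"


subsection \<open>The warped product\<close>

text \<open>\<open>real \<times> (real ^ 'n)\<close> is the space \<open>E\<close> of dimension \<open>n + 1\<close>, \<open>n = CARD('n)\<close>; its first
  component is the coordinate which carries the sign \<open>\<epsilon>\<close>.\<close>

definition eform :: "real \<Rightarrow> real \<times> (real ^ 'n::finite) \<Rightarrow> real \<times> (real ^ 'n) \<Rightarrow> real" where
  "eform \<epsilon> x y = \<epsilon> * fst x * fst y + snd x \<bullet> snd y"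

definition Q :: "real \<Rightarrow> (real \<times> (real ^ 'n::finite)) set" where
  "Q \<epsilon> = {x. eform \<epsilon> x x = \<epsilon> \<and> (\<epsilon> = -1 \<longrightarrow> fst x > 0)}"

text \<open>The warped product is the set \<open>UNIV \<times> Q \<epsilon>\<close>.  Its tangent vectors are regarded as elements
  of the vector space \<open>real \<times> (real \<times> (real ^ 'n))\<close> that contains it; in particular the vector
  field \<open>\<partial>\<^sub>t\<close> is constantly \<open>(1, 0)\<close>.\<close>

type_synonym 'n ambient = "real \<times> (real \<times> (real ^ 'n))"

definition wtangent :: "real \<Rightarrow> 'n::finite ambient \<Rightarrow> 'n ambient set" where
  "wtangent \<epsilon> q = {w. eform \<epsilon> (snd q) (snd w) = 0}"

definition wmetric ::
    "real \<Rightarrow> (real \<Rightarrow> real) \<Rightarrow> 'n::finite ambient \<Rightarrow> 'n ambient \<Rightarrow> 'n ambient \<Rightarrow> real" where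
  "wmetric \<epsilon> \<rho> q v w = fst v * fst w + (\<rho> (fst q))\<^sup>2 * eform \<epsilon> (snd v) (snd w)"

text \<open>The Levi-Civita connection of the warped product is \<open>D\<^sub>v W + wchristoffel \<epsilon> \<rho> q v W\<close>,
  where \<open>D\<close> is the derivative of maps into \<open>real \<times> (real \<times> (real ^ 'n))\<close>.  The lemmas
  \<open>wchristoffel_sym\<close>, \<open>wconn_tangent\<close> and \<open>wconn_metric\<close> state the properties that characterise it:
  it is torsion-free, has values tangent to the warped product and is compatible with the metric.\<close>

definition wchristoffel ::
    "real \<Rightarrow> (real \<Rightarrow> real) \<Rightarrow> 'n::finite ambient \<Rightarrow> 'n ambient \<Rightarrow> 'n ambient \<Rightarrow> 'n ambient" where
  "wchristoffel \<epsilon> \<rho> q v w =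
     (- \<rho> (fst q) * deriv \<rho> (fst q) * eform \<epsilon> (snd v) (snd w),
      (deriv \<rho> (fst q) / \<rho> (fst q)) *\<^sub>R (fst v *\<^sub>R snd w + fst w *\<^sub>R snd v)
        + (\<epsilon> * eform \<epsilon> (snd v) (snd w)) *\<^sub>R snd q)"

lemma eform_sym: "eform \<epsilon> x y = eform \<epsilon> y x"
  by (simp add: eform_def inner_commute)

lemma eform_linear:
  "eform \<epsilon> x (y + z) = eform \<epsilon> x y + eform \<epsilon> x z"
  "eform \<epsilon> (y + z) x = eform \<epsilon> y x + eform \<epsilon> z x"
  "eform \<epsilon> x (a *\<^sub>R y) = a * eform \<epsilon> x y"
  "eform \<epsilon> (a *\<^sub>R y) x = a * eform \<epsilon> y x"
  by (simp_all add: eform_def algebra_simps)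

lemma bounded_bilinear_eform: "bounded_bilinear (eform \<epsilon>)"
proof -
  have "bilinear (eform \<epsilon>)"
    unfolding bilinear_def by (intro conjI allI linearI) (simp_all only: eform_linear real_scaleR_def)
  then show ?thesis
    by (simp add: bilinear_conv_bounded_bilinear)
qed

lemma wchristoffel_sym: "wchristoffel \<epsilon> \<rho> q v w = wchristoffel \<epsilon> \<rho> q w v"
  by (simp add: wchristoffel_def eform_sym[of \<epsilon> "snd v"] add.commute)

lemma wconn_tangent:
  fixes \<gamma> W :: "real \<Rightarrow> 'n::finite ambient"
  assumes eps: "\<epsilon> = 1 \<or> \<epsilon> = -1"
    and \<gamma>: "\<And>r. \<gamma> r \<in> UNIV \<times> Q \<epsilon>" "(\<gamma> has_vector_derivative v) (at s)"
    and W: "\<And>r. W r \<in> wtangent \<epsilon> (\<gamma> r)" "(W has_vector_derivative w) (at s)"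
  shows "w + wchristoffel \<epsilon> \<rho> (\<gamma> s) v (W s) \<in> wtangent \<epsilon> (\<gamma> s)"
proof -
  note d = bounded_linear.has_vector_derivative[OF bounded_linear_snd]
  note b = bounded_bilinear.has_vector_derivative[OF bounded_bilinear_eform]
  have "((\<lambda>r. eform \<epsilon> (snd (\<gamma> r)) (snd (W r))) has_vector_derivative
      eform \<epsilon> (snd (\<gamma> s)) (snd w) + eform \<epsilon> (snd v) (snd (W s))) (at s)"
    by (rule b[OF d[OF \<gamma>(2)] d[OF W(2)]])
  moreover have "(\<lambda>r. eform \<epsilon> (snd (\<gamma> r)) (snd (W r))) = (\<lambda>r. 0)"
    using W(1) by (auto simp: wtangent_def)
  ultimately have 1: "eform \<epsilon> (snd (\<gamma> s)) (snd w) + eform \<epsilon> (snd v) (snd (W s)) = 0"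
    by (metis has_vector_derivative_const vector_derivative_unique_at)
  have "((\<lambda>r. eform \<epsilon> (snd (\<gamma> r)) (snd (\<gamma> r))) has_vector_derivative
      eform \<epsilon> (snd (\<gamma> s)) (snd v) + eform \<epsilon> (snd v) (snd (\<gamma> s))) (at s)"
    by (rule b[OF d[OF \<gamma>(2)] d[OF \<gamma>(2)]])
  moreover have "(\<lambda>r. eform \<epsilon> (snd (\<gamma> r)) (snd (\<gamma> r))) = (\<lambda>r. \<epsilon>)"
    using \<gamma>(1) by (auto simp: Q_def mem_Times_iff)
  ultimately have "eform \<epsilon> (snd (\<gamma> s)) (snd v) + eform \<epsilon> (snd v) (snd (\<gamma> s)) = 0"
    by (metis has_vector_derivative_const vector_derivative_unique_at)
  then have 2: "eform \<epsilon> (snd (\<gamma> s)) (snd v) = 0"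
    by (simp add: eform_sym)
  have 3: "eform \<epsilon> (snd (\<gamma> s)) (snd (W s)) = 0" "eform \<epsilon> (snd (\<gamma> s)) (snd (\<gamma> s)) = \<epsilon>"
    using W(1)[of s] \<gamma>(1)[of s] by (auto simp: wtangent_def Q_def mem_Times_iff)
  show ?thesis
    using eps 1 2 3
    by (auto simp: wtangent_def wchristoffel_def eform_linear)
qed

lemma wconn_metric:
  fixes \<gamma> W Z :: "real \<Rightarrow> 'n::finite ambient"
  assumes \<rho>: "\<And>t. \<rho> differentiable (at t)" "\<And>t. \<rho> t > 0"
    and \<gamma>: "(\<gamma> has_vector_derivative v) (at s)"
    and W: "W s \<in> wtangent \<epsilon> (\<gamma> s)" "(W has_vector_derivative w) (at s)"
    and Z: "Z s \<in> wtangent \<epsilon> (\<gamma> s)" "(Z has_vector_derivative z) (at s)"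
  shows "((\<lambda>r. wmetric \<epsilon> \<rho> (\<gamma> r) (W r) (Z r)) has_real_derivative
      wmetric \<epsilon> \<rho> (\<gamma> s) (w + wchristoffel \<epsilon> \<rho> (\<gamma> s) v (W s)) (Z s)
      + wmetric \<epsilon> \<rho> (\<gamma> s) (W s) (z + wchristoffel \<epsilon> \<rho> (\<gamma> s) v (Z s))) (at s)"
proof -
  note d = bounded_linear.has_vector_derivative[OF bounded_linear_snd]
  note d' = bounded_linear.has_vector_derivative[OF bounded_linear_fst]
  note b = bounded_bilinear.has_vector_derivative[OF bounded_bilinear_eform]
  have E: "((\<lambda>r. eform \<epsilon> (snd (W r)) (snd (Z r))) has_real_derivative
      eform \<epsilon> (snd (W s)) (snd z) + eform \<epsilon> (snd w) (snd (Z s))) (at s)"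
    using b[OF d[OF W(2)] d[OF Z(2)]]
    by (simp add: has_real_derivative_iff_has_vector_derivative)
  have F: "((\<lambda>r. fst (\<gamma> r)) has_real_derivative fst v) (at s)"
      "((\<lambda>r. fst (W r)) has_real_derivative fst w) (at s)"
      "((\<lambda>r. fst (Z r)) has_real_derivative fst z) (at s)"
    using d'[OF \<gamma>] d'[OF W(2)] d'[OF Z(2)]
    by (simp_all add: has_real_derivative_iff_has_vector_derivative)
  have "(\<rho> has_real_derivative deriv \<rho> (fst (\<gamma> s))) (at (fst (\<gamma> s)))"
    using \<rho>(1) by (simp add: DERIV_deriv_iff_real_differentiable)
  from DERIV_chain2[OF this F(1)]
  have R: "((\<lambda>r. \<rho> (fst (\<gamma> r))) has_real_derivative deriv \<rho> (fst (\<gamma> s)) * fst v) (at s)" .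
  have 0: "eform \<epsilon> (snd (\<gamma> s)) (snd (W s)) = 0" "eform \<epsilon> (snd (W s)) (snd (\<gamma> s)) = 0"
      "eform \<epsilon> (snd (\<gamma> s)) (snd (Z s)) = 0" "eform \<epsilon> (snd (Z s)) (snd (\<gamma> s)) = 0"
    using W(1) Z(1) by (auto simp: wtangent_def eform_sym)
  have "\<rho> (fst (\<gamma> s)) \<noteq> 0"
    using \<rho>(2)[of "fst (\<gamma> s)"] by simp
  then show ?thesis
    unfolding wmetric_def wchristoffel_def
    apply (auto intro!: derivative_eq_intros E F R)
    apply (simp add: eform_linear 0 eform_sym[of \<epsilon> "snd v"])
    apply (simp add: field_simps power2_eq_square eform_sym)
    done
qed

text \<open>If \<open>\<epsilon> = -1\<close>, a subspace of \<open>E\<close> may miss \<open>Q \<epsilon>\<close>; if it does not, the intersection has the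
  dimension \<open>k\<close>.  By \<open>wconn_slice\<close>, \<open>UNIV \<times> S\<close> is totally geodesic in the warped product:
  its tangent space at \<open>q\<close> is \<open>(UNIV \<times> V) \<inter> wtangent \<epsilon> q\<close>, with \<open>S = Q \<epsilon> \<inter> V\<close>.\<close>

definition totally_geodesic_Q :: "real \<Rightarrow> nat \<Rightarrow> (real \<times> (real ^ 'n::finite)) set \<Rightarrow> bool" where
  "totally_geodesic_Q \<epsilon> k S \<longleftrightarrow>
     (\<exists>V. subspace V \<and> dim V = k + 1 \<and> S = Q \<epsilon> \<inter> V \<and> S \<noteq> {})"

lemma wconn_slice:
  fixes \<gamma> W :: "real \<Rightarrow> 'n::finite ambient"
  assumes eps: "\<epsilon> = 1 \<or> \<epsilon> = -1" and V: "subspace V"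
    and \<gamma>: "\<And>r. \<gamma> r \<in> UNIV \<times> (Q \<epsilon> \<inter> V)" "(\<gamma> has_vector_derivative v) (at s)"
    and W: "\<And>r. W r \<in> (UNIV \<times> V) \<inter> wtangent \<epsilon> (\<gamma> r)" "(W has_vector_derivative w) (at s)"
  shows "w + wchristoffel \<epsilon> \<rho> (\<gamma> s) v (W s) \<in> (UNIV \<times> V) \<inter> wtangent \<epsilon> (\<gamma> s)"
proof -
  have deriv_in: "snd y' \<in> V"
    if y: "\<And>r. snd (y r) \<in> V" "(y has_vector_derivative y') (at s)"
    for y :: "real \<Rightarrow> 'n ambient" and y'
  proof -
    have "snd y' \<bullet> z = 0" if z: "z \<in> V\<^sup>\<bottom>" for z
    proof -
      have "((\<lambda>r. snd (y r) \<bullet> z) has_vector_derivative snd y' \<bullet> z) (at s)"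
        by (intro bounded_linear.has_vector_derivative[OF bounded_linear_inner_left]
            bounded_linear.has_vector_derivative[OF bounded_linear_snd] y(2))
      moreover have "(\<lambda>r. snd (y r) \<bullet> z) = (\<lambda>r. 0)"
        using y(1) z by (auto simp: orthogonal_comp_def orthogonal_def)
      ultimately show ?thesis
        by (metis has_vector_derivative_const vector_derivative_unique_at)
    qed
    then have "snd y' \<in> V\<^sup>\<bottom>\<^sup>\<bottom>"
      by (auto simp: orthogonal_comp_def[of "V\<^sup>\<bottom>"] orthogonal_def inner_commute)
    then show ?thesis
      by (simp add: orthogonal_comp_self[OF V])
  qed
  have "w + wchristoffel \<epsilon> \<rho> (\<gamma> s) v (W s) \<in> wtangent \<epsilon> (\<gamma> s)"
    by (rule wconn_tangent[OF eps _ \<gamma>(2) _ W(2)]) (use \<gamma>(1) W(1) in \<open>auto simp: mem_Times_iff\<close>)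
  moreover have "snd v \<in> V" "snd w \<in> V"
    using deriv_in[OF _ \<gamma>(2)] deriv_in[OF _ W(2)] \<gamma>(1) W(1) by (auto simp: mem_Times_iff)
  moreover have "snd (\<gamma> s) \<in> V" "snd (W s) \<in> V"
    using \<gamma>(1)[of s] W(1)[of s] by (auto simp: mem_Times_iff)
  ultimately show ?thesis
    using V by (auto simp: mem_Times_iff wchristoffel_def intro!: subspace_add subspace_scale)
qed


subsection \<open>Isometric immersions into the warped product\<close>

definition isometric_immersion ::
    "real \<Rightarrow> (real \<Rightarrow> real) \<Rightarrow> ('a, 'm::finite) chart set
      \<Rightarrow> (('a, 'm) chart \<Rightarrow> 'a \<Rightarrow> real ^ 'm \<Rightarrow> real ^ 'm \<Rightarrow> real)
      \<Rightarrow> ('a \<Rightarrow> 'n::finite ambient) \<Rightarrow> bool" where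
  "isometric_immersion \<epsilon> \<rho> A g f \<longleftrightarrow>
     range f \<subseteq> UNIV \<times> Q \<epsilon> \<and> smooth_along A UNIV f \<and>
     (\<forall>c\<in>A. \<forall>p\<in>fst c. inj (dir_deriv c f p) \<and>
        (\<forall>u v. wmetric \<epsilon> \<rho> (f p) (dir_deriv c f p u) (dir_deriv c f p v) = g c p u v))"

text \<open>The image of the tangent space at \<open>p\<close> under the differential of \<open>f\<close>, which is the same for
  all charts \<open>c\<close> around \<open>p\<close>.\<close>

definition tangent_image ::
    "('a, 'm::finite) chart set \<Rightarrow> ('a \<Rightarrow> 'n::finite ambient) \<Rightarrow> 'a \<Rightarrow> 'n ambient set" where
  "tangent_image A f p = {dir_deriv c f p u | c u. c \<in> A \<and> p \<in> fst c}"

definition normal_space ::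
    "real \<Rightarrow> (real \<Rightarrow> real) \<Rightarrow> ('a, 'm::finite) chart set \<Rightarrow> ('a \<Rightarrow> 'n::finite ambient)
      \<Rightarrow> 'a \<Rightarrow> 'n ambient set" where
  "normal_space \<epsilon> \<rho> A f p =
     {w \<in> wtangent \<epsilon> (f p). \<forall>v\<in>tangent_image A f p. wmetric \<epsilon> \<rho> (f p) w v = 0}"

text \<open>The normal component of a vector \<open>w\<close> tangent to the warped product at \<open>f p\<close>; it is unique as
  the metric is positive definite on \<open>wtangent \<epsilon> (f p)\<close>.\<close>

definition normal_part ::
    "real \<Rightarrow> (real \<Rightarrow> real) \<Rightarrow> ('a, 'm::finite) chart set \<Rightarrow> ('a \<Rightarrow> 'n::finite ambient)
      \<Rightarrow> 'a \<Rightarrow> 'n ambient \<Rightarrow> 'n ambient" where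
  "normal_part \<epsilon> \<rho> A f p w =
     (THE \<xi>. \<xi> \<in> normal_space \<epsilon> \<rho> A f p \<and> w - \<xi> \<in> tangent_image A f p)"

definition eta ::
    "real \<Rightarrow> (real \<Rightarrow> real) \<Rightarrow> ('a, 'm::finite) chart set \<Rightarrow> ('a \<Rightarrow> 'n::finite ambient)
      \<Rightarrow> 'a \<Rightarrow> 'n ambient" where
  "eta \<epsilon> \<rho> A f p = normal_part \<epsilon> \<rho> A f p (1, 0)"

text \<open>The connection of the warped product for a vector field \<open>\<xi>\<close> along \<open>f\<close>, in the direction of
  the tangent vector with coordinates \<open>u\<close> in \<open>c\<close>.\<close>

definition cov_deriv ::
    "real \<Rightarrow> (real \<Rightarrow> real) \<Rightarrow> ('a, 'm::finite) chart \<Rightarrow> ('a \<Rightarrow> 'n::finite ambient)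
      \<Rightarrow> ('a \<Rightarrow> 'n ambient) \<Rightarrow> 'a \<Rightarrow> real ^ 'm \<Rightarrow> 'n ambient" where
  "cov_deriv \<epsilon> \<rho> c f \<xi> p u =
     dir_deriv c \<xi> p u + wchristoffel \<epsilon> \<rho> (f p) (dir_deriv c f p u) (\<xi> p)"

text \<open>The second fundamental form is the normal component of the covariant derivative of a
  tangent vector field; as it is tensorial, it is enough to extend the coordinate vector \<open>v\<close> to the
  vector field with constant coordinates in \<open>c\<close>.\<close>

definition second_ff ::
    "real \<Rightarrow> (real \<Rightarrow> real) \<Rightarrow> ('a, 'm::finite) chart set \<Rightarrow> ('a, 'm) chart
      \<Rightarrow> ('a \<Rightarrow> 'n::finite ambient) \<Rightarrow> 'a \<Rightarrow> real ^ 'm \<Rightarrow> real ^ 'm \<Rightarrow> 'n ambient" where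
  "second_ff \<epsilon> \<rho> A c f p u v =
     normal_part \<epsilon> \<rho> A f p (cov_deriv \<epsilon> \<rho> c f (\<lambda>q. dir_deriv c f q v) p u)"

definition normal_conn ::
    "real \<Rightarrow> (real \<Rightarrow> real) \<Rightarrow> ('a, 'm::finite) chart set \<Rightarrow> ('a, 'm) chart
      \<Rightarrow> ('a \<Rightarrow> 'n::finite ambient) \<Rightarrow> ('a \<Rightarrow> 'n ambient) \<Rightarrow> 'a \<Rightarrow> real ^ 'm \<Rightarrow> 'n ambient" where
  "normal_conn \<epsilon> \<rho> A c f \<xi> p u = normal_part \<epsilon> \<rho> A f p (cov_deriv \<epsilon> \<rho> c f \<xi> p u)"

definition first_normal ::
    "real \<Rightarrow> (real \<Rightarrow> real) \<Rightarrow> ('a, 'm::finite) chart set \<Rightarrow> ('a \<Rightarrow> 'n::finite ambient)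
      \<Rightarrow> 'a \<Rightarrow> 'n ambient set" where
  "first_normal \<epsilon> \<rho> A f p = span {second_ff \<epsilon> \<rho> A c f p u v | c u v. c \<in> A \<and> p \<in> fst c}"

definition normal_section ::
    "real \<Rightarrow> (real \<Rightarrow> real) \<Rightarrow> ('a::topological_space, 'm::finite) chart set
      \<Rightarrow> ('a \<Rightarrow> 'n::finite ambient) \<Rightarrow> 'a set \<Rightarrow> ('a \<Rightarrow> 'n ambient) \<Rightarrow> bool" where
  "normal_section \<epsilon> \<rho> A f W \<xi> \<longleftrightarrow>
     open W \<and> smooth_along A W \<xi> \<and> (\<forall>p\<in>W. \<xi> p \<in> normal_space \<epsilon> \<rho> A f p)"

text \<open>Smooth local frames of \<open>L\<close> exist: \<open>l\<close> vectors which span a space of dimension \<open>l\<close> are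
  linearly independent.\<close>

definition normal_subbundle ::
    "real \<Rightarrow> (real \<Rightarrow> real) \<Rightarrow> ('a::topological_space, 'm::finite) chart set
      \<Rightarrow> ('a \<Rightarrow> 'n::finite ambient) \<Rightarrow> ('a \<Rightarrow> 'n ambient set) \<Rightarrow> nat \<Rightarrow> bool" where
  "normal_subbundle \<epsilon> \<rho> A f L l \<longleftrightarrow>
     (\<forall>p. \<exists>W \<xi>. p \<in> W \<and> open W \<and> (\<forall>i<l. normal_section \<epsilon> \<rho> A f W (\<xi> i)) \<and>
        (\<forall>q\<in>W. L q = span ((\<lambda>i. \<xi> i q) ` {..<l}) \<and> dim (L q) = l))"

text \<open>\<open>\<nabla>\<^sup>\<bottom> N \<subseteq> L\<close>\<close>

definition normal_conn_maps_into ::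
    "real \<Rightarrow> (real \<Rightarrow> real) \<Rightarrow> ('a::topological_space, 'm::finite) chart set
      \<Rightarrow> ('a \<Rightarrow> 'n::finite ambient) \<Rightarrow> ('a \<Rightarrow> 'n ambient set) \<Rightarrow> ('a \<Rightarrow> 'n ambient set) \<Rightarrow> bool" where
  "normal_conn_maps_into \<epsilon> \<rho> A f N L \<longleftrightarrow>
     (\<forall>W \<xi>. normal_section \<epsilon> \<rho> A f W \<xi> \<and> (\<forall>q\<in>W. \<xi> q \<in> N q) \<longrightarrow>
        (\<forall>c\<in>A. \<forall>p\<in>fst c \<inter> W. \<forall>u. normal_conn \<epsilon> \<rho> A c f \<xi> p u \<in> L p))"

end

theory Submission
  imports Defs
begin

text \<open>Put \<open>P = TM \<oplus> L\<close>, which contains \<open>\<partial>\<^sub>t = T + \<eta>\<close>.  The fields \<open>f\<^sub>* X\<close> and \<open>\<alpha>(X, Y)\<close>, with \<open>X\<close> and \<open>Y\<close>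
  constant in a chart, have covariant derivatives in \<open>P\<close>: this is the Gauss formula for the former
  and the hypothesis on \<open>\<nabla>\<^sup>\<bottom> N\<^sub>1\<close> for the latter.  Together with \<open>\<partial>\<^sub>t\<close> they span \<open>P\<close>, so \<open>\<eta>\<close> never has to be
  differentiated.  By the formula for the Christoffel symbols, the span \<open>V\<close> of the position vector
  \<open>\<pi>\<^sub>2 \<circ> f\<close> and of \<open>\<pi>\<^sub>2 P\<close> is then closed under the flat derivative of \<open>E\<close>.  Its dimension is constant,
  equal to \<open>m + l\<close>, because the projection of \<open>P\<close> loses exactly \<open>\<partial>\<^sub>t\<close> and the position vector is normal to
  the rest.  Hence \<open>V\<close> is a fixed subspace, and \<open>f\<close> takes values in \<open>\<real> \<times> (Q \<inter> V)\<close>.\<close>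

subsection \<open>Smooth maps\<close>

lemma Ck_on_cong:
  assumes "open S" "\<And>x. x \<in> S \<Longrightarrow> f x = g x"
  shows "Ck_on k S f \<longleftrightarrow> Ck_on k S g"
  using assms(2)
proof (induction k arbitrary: f g)
  case 0
  then show ?case
    by (auto cong: continuous_on_cong)
next
  case (Suc k)
  have *: "(f has_derivative f') (at x) \<longleftrightarrow> (g has_derivative f') (at x)" if "x \<in> S" for x f'
    using has_derivative_transform_within_open[OF _ assms(1) that] Suc.prems by metis
  have "frechet_derivative f (at x) v = frechet_derivative g (at x) v" if "x \<in> S" for x v
    using *[OF that] by (simp add: frechet_derivative_def)
  then have "Ck_on k S (\<lambda>x. frechet_derivative f (at x) v) \<longleftrightarrow>
      Ck_on k S (\<lambda>x. frechet_derivative g (at x) v)" for v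
    by (intro Suc.IH)
  then show ?case
    using * by (auto simp: differentiable_def)
qed

text \<open>\<open>Ck_on\<close> refers to the chosen \<open>frechet_derivative\<close>. This rule
  accepts any explicit formula for the derivative instead, so that each calculus rule below can work
  with its usual formula.\<close>

lemma Ck_on_SucI:
  assumes "open S" "\<And>x. x \<in> S \<Longrightarrow> (f has_derivative f' x) (at x)"
    and "\<And>v. Ck_on k S (\<lambda>x. f' x v)"
  shows "Ck_on (Suc k) S f"
proof -
  have "Ck_on k S (\<lambda>x. frechet_derivative f (at x) v)" for v
    by (rule iffD1[OF Ck_on_cong[OF assms(1)] assms(3)])
      (simp add: frechet_derivative_at[OF assms(2), symmetric])
  then show ?thesis
    using assms(2) by (auto simp: differentiable_def)
qed

lemma Ck_on_Suc_has_derivative: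
  assumes "Ck_on (Suc k) S f" "x \<in> S"
  shows "(f has_derivative frechet_derivative f (at x)) (at x)"
  using assms by (simp add: frechet_derivative_works)

lemma Ck_on_SucD: "Ck_on (Suc k) S f \<Longrightarrow> Ck_on k S f"
proof (induction k arbitrary: f)
  case 0
  then show ?case
    by (auto intro!: continuous_at_imp_continuous_on differentiable_imp_continuous_within)
next
  case (Suc k)
  have "Ck_on k S (\<lambda>x. frechet_derivative f (at x) v)" for v
    by (rule Suc.IH) (rule iffD1[OF Ck_on.simps(2) Suc.prems, THEN conjunct2, THEN spec])
  then show ?case
    using Suc.prems by simp
qed

lemma Ck_on_subset: "Ck_on k S f \<Longrightarrow> T \<subseteq> S \<Longrightarrow> Ck_on k T f"
  by (induction k arbitrary: f) (auto intro: continuous_on_subset)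

lemma Ck_on_const: "open S \<Longrightarrow> Ck_on k S (\<lambda>x. c)"
proof (induction k arbitrary: c)
  case (Suc k)
  then show ?case
    by (intro Ck_on_SucI[where f' = "\<lambda>x v. 0"]) auto
qed auto

lemma Ck_on_bounded_linear:
  assumes "bounded_linear T" "open S"
  shows "Ck_on k S f \<Longrightarrow> Ck_on k S (\<lambda>x. T (f x))"
proof (induction k arbitrary: f)
  case 0
  then show ?case
    by (simp add: bounded_linear.continuous_on[OF assms(1)])
next
  case (Suc k)
  show ?case
    by (rule Ck_on_SucI[OF assms(2)
          bounded_linear.has_derivative[OF assms(1) Ck_on_Suc_has_derivative[OF Suc.prems]]])
      (use Suc in auto)
qed

lemma Ck_on_add:
  assumes "open S"
  shows "Ck_on k S f \<Longrightarrow> Ck_on k S g \<Longrightarrow> Ck_on k S (\<lambda>x. f x + g x)"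
proof (induction k arbitrary: f g)
  case 0
  then show ?case
    by (simp add: continuous_on_add)
next
  case (Suc k)
  show ?case
    by (rule Ck_on_SucI[OF assms has_derivative_add[OF
            Ck_on_Suc_has_derivative[OF Suc.prems(1)] Ck_on_Suc_has_derivative[OF Suc.prems(2)]]])
      (use Suc in auto)
qed

lemma Ck_on_sum:
  assumes "open S" "\<And>i. i \<in> I \<Longrightarrow> Ck_on k S (f i)"
  shows "Ck_on k S (\<lambda>x. \<Sum>i\<in>I. f i x)"
  using assms(2)
  by (induction I rule: infinite_finite_induct) (auto simp: Ck_on_const Ck_on_add assms(1))

text \<open>The product rule writes the derivative as a sum of two products of the same kind, so the
  induction closes with \<open>f\<close> and \<open>g\<close> arbitrary. The factor that is not
  differentiated loses one order by \<open>Ck_on_SucD\<close>.\<close>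

lemma Ck_on_bounded_bilinear:
  assumes "bounded_bilinear prd" "open S"
  shows "Ck_on k S f \<Longrightarrow> Ck_on k S g \<Longrightarrow> Ck_on k S (\<lambda>x. prd (f x) (g x))"
proof (induction k arbitrary: f g)
  case 0
  then show ?case
    by (simp add: bounded_bilinear.continuous_on[OF assms(1)])
next
  case (Suc k)
  have d: "((\<lambda>x. prd (f x) (g x)) has_derivative (\<lambda>v. prd (f x) (frechet_derivative g (at x) v) +
      prd (frechet_derivative f (at x) v) (g x))) (at x)" if "x \<in> S" for x
    by (rule bounded_bilinear.FDERIV[OF assms(1) Ck_on_Suc_has_derivative[OF Suc.prems(1) that]
          Ck_on_Suc_has_derivative[OF Suc.prems(2) that]])
  have c: "Ck_on k S f" "Ck_on k S g"
    by (rule Suc.prems[THEN Ck_on_SucD])+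
  have "Ck_on k S (\<lambda>x. frechet_derivative f (at x) v)"
      "Ck_on k S (\<lambda>x. frechet_derivative g (at x) v)" for v
    using Suc.prems by auto
  then have "Ck_on k S (\<lambda>x. prd (f x) (frechet_derivative g (at x) v) +
      prd (frechet_derivative f (at x) v) (g x))" for v
    by (intro Ck_on_add[OF assms(2)] Suc.IH c)
  with d show ?case
    by (rule Ck_on_SucI[OF assms(2)])
qed

text \<open>In the chain rule the direction \<open>?f' x v\<close> depends on \<open>x\<close>,
  whereas \<open>Ck_on\<close> speaks of derivatives in fixed directions. Expanding the direction in
  \<open>Basis\<close> leaves only derivatives of \<open>g\<close> in fixed directions, composed
  with \<open>f\<close>, and the induction hypothesis covers these.\<close>

lemma Ck_on_compose:
  fixes f :: "'a::real_normed_vector \<Rightarrow> 'b::euclidean_space" and g :: "'b \<Rightarrow> 'c::real_normed_vector"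
  assumes "open S" "open T" "\<And>x. x \<in> S \<Longrightarrow> f x \<in> T"
  shows "Ck_on k S f \<Longrightarrow> Ck_on k T g \<Longrightarrow> Ck_on k S (\<lambda>x. g (f x))"
proof (induction k arbitrary: g)
  case 0
  then show ?case
    using assms(3) by (auto intro: continuous_on_compose2)
next
  case (Suc k)
  let ?f' = "\<lambda>x. frechet_derivative f (at x)" and ?g' = "\<lambda>x. frechet_derivative g (at x)"
  have f': "(f has_derivative ?f' x) (at x)" if "x \<in> S" for x
    using Ck_on_Suc_has_derivative[OF Suc.prems(1) that] .
  have g': "(g has_derivative ?g' (f x)) (at (f x))" if "x \<in> S" for x
    using Ck_on_Suc_has_derivative[OF Suc.prems(2) assms(3)[OF that]] .
  have "((\<lambda>x. g (f x)) has_derivative (\<lambda>v. \<Sum>b\<in>Basis. (?f' x v \<bullet> b) *\<^sub>R ?g' (f x) b)) (at x)"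
    if "x \<in> S" for x
  proof -
    interpret bounded_linear "?g' (f x)"
      using g'[OF that] by (rule has_derivative_bounded_linear)
    have "?g' (f x) (?f' x v) = (\<Sum>b\<in>Basis. (?f' x v \<bullet> b) *\<^sub>R ?g' (f x) b)" for v
      by (subst euclidean_representation[of "?f' x v", symmetric]) (simp add: sum scaleR)
    then show ?thesis
      using diff_chain_at[OF f'[OF that] g'[OF that]] by (simp add: comp_def)
  qed
  moreover have "Ck_on k S (\<lambda>x. \<Sum>b\<in>Basis. (?f' x v \<bullet> b) *\<^sub>R ?g' (f x) b)" for v
  proof (intro Ck_on_sum[OF assms(1)] Ck_on_bounded_bilinear[OF bounded_bilinear_scaleR assms(1)])
    fix b :: 'b
    show "Ck_on k S (\<lambda>x. ?f' x v \<bullet> b)"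
      using Suc.prems by (intro Ck_on_bounded_linear[OF bounded_linear_inner_left assms(1)]) auto
    show "Ck_on k S (\<lambda>x. ?g' (f x) b)"
      using Suc.prems(2) by (intro Suc.IH Ck_on_SucD[OF Suc.prems(1)]) auto
  qed
  ultimately show ?case
    by (rule Ck_on_SucI[OF assms(1)])
qed

text \<open>The derivative of \<open>inverse\<close> is a product of copies of
  \<open>inverse\<close> and a constant, so its regularity of order \<open>k\<close> follows from
  that of \<open>inverse\<close> itself.\<close>

lemma Ck_on_inverse: "Ck_on k (- {0}) (inverse :: real \<Rightarrow> real)"
proof (induction k)
  case 0
  then show ?case
    by (auto intro: continuous_on_inverse)
next
  case (Suc k)
  have o: "open (- {0::real})"
    by auto
  have "Ck_on k (- {0}) (\<lambda>x::real. - (inverse x * v * inverse x))" for v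
    by (intro Ck_on_bounded_linear[OF bounded_linear_minus[OF bounded_linear_ident]]
        Ck_on_bounded_bilinear[OF bounded_bilinear_mult] Ck_on_const Suc o)
  moreover have "(inverse has_derivative (\<lambda>v. - (inverse x * v * inverse x))) (at x)"
    if "x \<in> - {0}" for x :: real
    using that by (intro has_derivative_inverse') auto
  ultimately show ?case
    by (intro Ck_on_SucI[OF o, where f' = "\<lambda>x v. - (inverse x * v * inverse x)"])
qed

section \<open>Smooth maps: calculus rules and locality\<close>

lemma smooth_on_cong:
  "open S \<Longrightarrow> (\<And>x. x \<in> S \<Longrightarrow> f x = g x) \<Longrightarrow> smooth_on S f \<longleftrightarrow> smooth_on S g"
  unfolding smooth_on_def by (rule iff_allI, rule Ck_on_cong)

lemma smooth_on_subset: "smooth_on S f \<Longrightarrow> T \<subseteq> S \<Longrightarrow> smooth_on T f"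
  unfolding smooth_on_def by (intro allI, erule allE, erule Ck_on_subset)

lemma smooth_on_const: "open S \<Longrightarrow> smooth_on S (\<lambda>x. c)"
  by (simp add: smooth_on_def Ck_on_const)

lemma smooth_on_bounded_linear:
  "smooth_on S f \<Longrightarrow> open S \<Longrightarrow> bounded_linear T \<Longrightarrow> smooth_on S (\<lambda>x. T (f x))"
  by (simp add: smooth_on_def Ck_on_bounded_linear)

lemma smooth_on_add:
  "open S \<Longrightarrow> smooth_on S f \<Longrightarrow> smooth_on S g \<Longrightarrow> smooth_on S (\<lambda>x. f x + g x)"
  by (simp add: smooth_on_def Ck_on_add)

lemma smooth_on_bounded_bilinear:
  "bounded_bilinear prd \<Longrightarrow> open S \<Longrightarrow> smooth_on S f \<Longrightarrow> smooth_on S g \<Longrightarrow>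
    smooth_on S (\<lambda>x. prd (f x) (g x))"
  by (simp add: smooth_on_def Ck_on_bounded_bilinear)

lemmas smooth_on_mult = smooth_on_bounded_bilinear[OF bounded_bilinear_mult]
lemmas smooth_on_scaleR = smooth_on_bounded_bilinear[OF bounded_bilinear_scaleR]

lemma smooth_on_diff:
  assumes "open S" "smooth_on S f" "smooth_on S g"
  shows "smooth_on S (\<lambda>x. f x - g x)"
  using smooth_on_add[OF assms(1,2) smooth_on_bounded_linear[OF assms(3,1)
        bounded_linear_minus[OF bounded_linear_ident]]] by simp

lemma smooth_on_compose:
  fixes f :: "'a::real_normed_vector \<Rightarrow> 'b::euclidean_space"
  assumes "open S" "open T" "\<And>x. x \<in> S \<Longrightarrow> f x \<in> T" "smooth_on S f" "smooth_on T g"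
  shows "smooth_on S (\<lambda>x. g (f x))"
  using assms by (simp add: smooth_on_def Ck_on_compose[where T = T])

lemma smooth_on_divide:
  fixes f g :: "'a::real_normed_vector \<Rightarrow> real"
  assumes "open S" "smooth_on S f" "smooth_on S g" "\<And>x. x \<in> S \<Longrightarrow> g x \<noteq> 0"
  shows "smooth_on S (\<lambda>x. f x / g x)"
proof -
  have "smooth_on (- {0}) (inverse :: real \<Rightarrow> real)"
    by (simp add: smooth_on_def Ck_on_inverse)
  then have "smooth_on S (\<lambda>x. inverse (g x))"
    using smooth_on_compose[OF assms(1) _ _ assms(3), of "- {0}" inverse] assms(4) by auto
  then show ?thesis
    unfolding divide_inverse by (rule smooth_on_mult[OF assms(1,2)])
qed

lemma smooth_on_Pair:
  fixes f :: "'a::real_normed_vector \<Rightarrow> 'b::real_normed_vector"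
    and g :: "'a::real_normed_vector \<Rightarrow> 'c::real_normed_vector"
  assumes "open S" "smooth_on S f" "smooth_on S g"
  shows "smooth_on S (\<lambda>x. (f x, g x))"
proof -
  have "bounded_linear (\<lambda>y::'b. (y, 0::'c))" "bounded_linear (\<lambda>y::'c. (0::'b, y))"
    by (intro bounded_linear_Pair bounded_linear_ident bounded_linear_zero)+
  from smooth_on_add[OF assms(1) smooth_on_bounded_linear[OF assms(2,1) this(1)]
      smooth_on_bounded_linear[OF assms(3,1) this(2)]]
  show ?thesis
    by simp
qed

lemma smooth_on_has_derivative:
  "smooth_on S f \<Longrightarrow> x \<in> S \<Longrightarrow> (f has_derivative frechet_derivative f (at x)) (at x)"
  unfolding smooth_on_def by (rule Ck_on_Suc_has_derivative[where k = 0], erule spec)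

lemma smooth_on_continuous_on: "smooth_on S f \<Longrightarrow> continuous_on S f"
  by (simp add: smooth_on_def del: Ck_on.simps flip: Ck_on.simps(1))

lemma smooth_on_frechet_derivative:
  assumes "smooth_on S f"
  shows "smooth_on S (\<lambda>x. frechet_derivative f (at x) v)"
  unfolding smooth_on_def
proof
  fix k
  show "Ck_on k S (\<lambda>x. frechet_derivative f (at x) v)"
    using assms[unfolded smooth_on_def, THEN spec, of "Suc k"] by simp
qed

lemma smooth_on_deriv:
  fixes f :: "real \<Rightarrow> real"
  assumes "open S" "smooth_on S f"
  shows "smooth_on S (deriv f)"
proof -
  \<comment> \<open>\<open>deriv\<close> is the derivative in the direction 1, so it inherits
    smoothness like any other directional derivative.\<close>
  have "frechet_derivative f (at x) 1 = deriv f x" if "x \<in> S" for x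
  proof -
    have "f differentiable (at x)"
      using smooth_on_has_derivative[OF assms(2) that] by (auto simp: differentiable_def)
    then have "(f has_derivative (*) (deriv f x)) (at x)"
      by (simp add: DERIV_deriv_iff_real_differentiable flip: has_field_derivative_def)
    then show ?thesis
      by (simp add: frechet_derivative_at[symmetric])
  qed
  then show ?thesis
    using smooth_on_cong[OF assms(1), of "\<lambda>x. frechet_derivative f (at x) 1" "deriv f"]
      smooth_on_frechet_derivative[OF assms(2)] by simp
qed

lemma Ck_on_local:
  assumes "\<And>x. x \<in> S \<Longrightarrow> \<exists>T. x \<in> T \<and> open T \<and> Ck_on k T f"
  shows "Ck_on k S f"
  using assms
proof (induction k arbitrary: f)
  case 0
  have "isCont f x" if "x \<in> S" for x
  proof -
    obtain T where "x \<in> T" "open T" "Ck_on 0 T f"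
      using 0[OF \<open>x \<in> S\<close>] by metis
    then show ?thesis
      by (simp add: continuous_on_eq_continuous_at)
  qed
  then show ?case
    by (simp add: continuous_at_imp_continuous_on)
next
  case (Suc k)
  have "\<exists>T. x \<in> T \<and> open T \<and> f differentiable (at x) \<and>
      (\<forall>v. Ck_on k T (\<lambda>x. frechet_derivative f (at x) v))" if "x \<in> S" for x
  proof -
    obtain T where "x \<in> T" "open T" "Ck_on (Suc k) T f"
      using Suc.prems[OF \<open>x \<in> S\<close>] by metis
    then show ?thesis
      by (intro exI[of _ T]) auto
  qed
  note * = this
  have "Ck_on k S (\<lambda>x. frechet_derivative f (at x) v)" for v
    by (rule Suc.IH) (use * in metis)
  moreover have "f differentiable (at x)" if "x \<in> S" for x
    using *[OF that] by metis
  ultimately show ?case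
    by simp
qed

text \<open>Used to glue the normal projections, which are constructed only near each point.\<close>

lemma smooth_on_local:
  assumes "\<And>x. x \<in> S \<Longrightarrow> \<exists>T. x \<in> T \<and> open T \<and> smooth_on T f"
  shows "smooth_on S f"
  unfolding smooth_on_def
proof
  fix k
  show "Ck_on k S f"
  proof (rule Ck_on_local)
    fix x
    assume "x \<in> S"
    then obtain T where "x \<in> T" "open T" "smooth_on T f"
      using assms by metis
    then show "\<exists>T. x \<in> T \<and> open T \<and> Ck_on k T f"
      by (auto simp: smooth_on_def)
  qed
qed


subsection \<open>Parallel families of subspaces\<close>

text \<open>Gram-Schmidt with smooth dependence on the parameter. It serves both the inner product
  of \<open>'b\<close> and the form \<open>wmetric\<close>, which is indefinite on the whole space
  if \<open>\<epsilon> = -1\<close>. Therefore \<open>B y v v\<close> is only assumed to be nonzero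
  on the span at the one point \<open>y\<close>, and \<open>N\<close> is shrunk until the divisors
  stay nonzero. The quantifier over \<open>T\<close> allows the induction hypothesis to be applied
  on the smaller neighbourhood.\<close>

lemma local_orthogonal_complement:
  fixes e :: "'i \<Rightarrow> 'x::real_normed_vector \<Rightarrow> 'b::euclidean_space" and B :: "'x \<Rightarrow> 'b \<Rightarrow> 'b \<Rightarrow> real"
  assumes S: "open S" "y \<in> S"
    and B: "\<And>x. x \<in> S \<Longrightarrow> bilinear (B x)"
    and B_smooth: "\<And>T u v. open T \<Longrightarrow> T \<subseteq> S \<Longrightarrow> smooth_on T u \<Longrightarrow> smooth_on T v \<Longrightarrow>
      smooth_on T (\<lambda>x. B x (u x) (v x))"
    and I: "finite I" "\<And>i. i \<in> I \<Longrightarrow> smooth_on S (e i)" "dim ((\<lambda>i. e i y) ` I) = card I"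
    and B_nz: "\<And>v. v \<in> span ((\<lambda>i. e i y) ` I) \<Longrightarrow> v \<noteq> 0 \<Longrightarrow> B y v v \<noteq> 0"
  shows "\<exists>N. open N \<and> y \<in> N \<and> N \<subseteq> S \<and> (\<forall>x\<in>N. dim ((\<lambda>i. e i x) ` I) = card I) \<and>
    (\<forall>T w. open T \<longrightarrow> T \<subseteq> N \<longrightarrow> smooth_on T w \<longrightarrow>
      (\<exists>z. smooth_on T z \<and> (\<forall>x\<in>T. w x - z x \<in> span ((\<lambda>i. e i x) ` I) \<and>
        (\<forall>v\<in>span ((\<lambda>i. e i x) ` I). B x (z x) v = 0))))"
  using I B_nz
proof (induction I rule: finite_induct)
  case empty
  have "\<exists>z. smooth_on T z \<and> (\<forall>x\<in>T. w x - z x = 0 \<and> B x (z x) 0 = 0)"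
    if "T \<subseteq> S" "smooth_on T w" for T w
    using that bilinear_rzero[OF B] by (intro exI[of _ w]) auto
  then show ?case
    using S by (intro exI[of _ S]) simp
next
  case (insert a I)
  let ?E = "\<lambda>x. (\<lambda>i. e i x) ` I"
  have card: "dim (?E y) \<le> card I" "dim (insert (e a y) (?E y)) = card I + 1"
    using insert.hyps insert.prems(2) dim_le_card'[of "?E y"] card_image_le[of I "\<lambda>i. e i y"] by auto
  \<comment> \<open>At \<open>y\<close> the vectors indexed by \<open>I\<close> span at most
    dimension \<open>card I\<close>, so adding \<open>e a y\<close> must raise the dimension and the
    earlier span must have full dimension.\<close>
  then have nin: "e a y \<notin> span (?E y)" and dim: "dim (?E y) = card I"
    by (auto simp: dim_insert split: if_splits)
  have "B y v v \<noteq> 0" if "v \<in> span (?E y)" "v \<noteq> 0" for v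
    using insert.prems(3)[of v] that span_mono[of "?E y" "insert (e a y) (?E y)"] by auto
  then obtain N where N: "open N" "y \<in> N" "N \<subseteq> S" "\<And>x. x \<in> N \<Longrightarrow> dim (?E x) = card I"
    and NZ: "\<And>T w. open T \<Longrightarrow> T \<subseteq> N \<Longrightarrow> smooth_on T w \<Longrightarrow>
      (\<exists>z. smooth_on T z \<and> (\<forall>x\<in>T. w x - z x \<in> span (?E x) \<and> (\<forall>v\<in>span (?E x). B x (z x) v = 0)))"
    using insert.IH[OF insert.prems(1) dim] by blast
  have "smooth_on N (e a)"
    using insert.prems(1)[of a] smooth_on_subset N(3) by auto
  from NZ[OF N(1) order_refl this]
  \<comment> \<open>\<open>za\<close> is \<open>e a\<close> made orthogonal to the earlier frame
    vectors on all of \<open>N\<close>.\<close>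
  obtain za where za: "smooth_on N za" "\<And>x. x \<in> N \<Longrightarrow> e a x - za x \<in> span (?E x)"
    "\<And>x v. x \<in> N \<Longrightarrow> v \<in> span (?E x) \<Longrightarrow> B x (za x) v = 0"
    by blast
  \<comment> \<open>The squared length of \<open>za\<close> is the divisor of the next projection.
    It is nonzero at \<open>y\<close>, since \<open>za y\<close> is a nonzero vector of the enlarged
    span, and hence on an open neighbourhood \<open>N'\<close> of \<open>y\<close>.\<close>
  define b where "b x = B x (za x) (za x)" for x
  have b: "smooth_on N b"
    unfolding b_def by (rule B_smooth[OF N(1,3) za(1,1)])
  define N' where "N' = {x \<in> N. b x \<noteq> 0}"
  have N': "N' \<subseteq> N" "N' \<subseteq> S"
    using N(3) by (auto simp: N'_def)
  have "N' = N \<inter> b -` (- {0})"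
    by (auto simp: N'_def)
  then have "open N'"
    using continuous_open_preimage[OF smooth_on_continuous_on[OF b] N(1), of "- {0}"] by auto
  have ea: "e a x \<in> span (?E x) \<longleftrightarrow> za x \<in> span (?E x)" if "x \<in> N" for x
    using span_add_eq2[OF za(2)[OF that], of "za x"] by simp
  have "za y \<noteq> 0"
    using ea[OF N(2)] nin by (metis span_zero)
  moreover have "za y \<in> span (insert (e a y) (?E y))"
  proof -
    have "za y = e a y - (e a y - za y)" by simp
    then show ?thesis
      using za(2)[OF N(2)] span_mono[of "?E y" "insert (e a y) (?E y)"]
      by (metis insertI1 span_base span_diff subset_insertI subsetD)
  qed
  ultimately have "b y \<noteq> 0"
    using insert.prems(3)[of "za y"] by (simp add: b_def)
  then have "y \<in> N'"
    using N(2) by (simp add: N'_def)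
  have dim': "dim ((\<lambda>i. e i x) ` insert a I) = card (insert a I)" if "x \<in> N'" for x
  proof -
    \<comment> \<open>Otherwise \<open>za x\<close> would lie in the span to which it is orthogonal,
      so \<open>b x\<close> would be zero.\<close>
    have "e a x \<notin> span (?E x)"
      using za(3)[of x "za x"] that ea[of x] by (auto simp: N'_def b_def)
    then show ?thesis
      using N(4)[of x] N' that insert.hyps by (simp add: dim_insert subset_iff)
  qed
  have "\<exists>z. smooth_on T z \<and> (\<forall>x\<in>T. w x - z x \<in> span ((\<lambda>i. e i x) ` insert a I) \<and>
        (\<forall>v\<in>span ((\<lambda>i. e i x) ` insert a I). B x (z x) v = 0))"
    if T: "open T" "T \<subseteq> N'" and w: "smooth_on T w" for T w
  proof -
    have TN: "T \<subseteq> N" "T \<subseteq> S"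
      using T N' by auto
    obtain z where z: "smooth_on T z" "\<And>x. x \<in> T \<Longrightarrow> w x - z x \<in> span (?E x)"
      "\<And>x v. x \<in> T \<Longrightarrow> v \<in> span (?E x) \<Longrightarrow> B x (z x) v = 0"
      using NZ[OF T(1) TN(1) w] by blast
    \<comment> \<open>The Gram-Schmidt coefficient: subtracting \<open>k\<close> times
      \<open>za\<close> from \<open>z\<close> makes it orthogonal to \<open>za\<close>.
      Orthogonality to the earlier span is kept, because \<open>z\<close> and \<open>za\<close> both
      have it.\<close>
    define k where "k x = B x (z x) (za x) / b x" for x
    have za_T: "smooth_on T za"
      by (rule smooth_on_subset[OF za(1) TN(1)])
    have "smooth_on T k"
      unfolding k_def using T(2)
      by (intro smooth_on_divide[OF T(1)] B_smooth[OF T(1) TN(2) z(1) za_T] smooth_on_subset[OF b TN(1)])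
        (auto simp: N'_def)
    then have 1: "smooth_on T (\<lambda>x. z x - k x *\<^sub>R za x)"
      by (intro smooth_on_diff smooth_on_scaleR z(1) za_T T(1))
    have "w x - (z x - k x *\<^sub>R za x) \<in> span ((\<lambda>i. e i x) ` insert a I) \<and>
        (\<forall>v\<in>span ((\<lambda>i. e i x) ` insert a I). B x (z x - k x *\<^sub>R za x) v = 0)" if "x \<in> T" for x
    proof
      have x: "x \<in> N" "x \<in> S" "b x \<noteq> 0"
        using that TN T(2) by (auto simp: N'_def)
      let ?E' = "(\<lambda>i. e i x) ` insert a I"
      have sub: "span (?E x) \<subseteq> span ?E'"
        by (intro span_mono) auto
      have zaE: "za x \<in> span ?E'"
      proof -
        have "e a x \<in> span ?E'" "e a x - za x \<in> span ?E'"
          using za(2)[OF x(1)] sub by (auto intro: span_base)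
        then show ?thesis
          using span_diff by fastforce
      qed
      have "w x - (z x - k x *\<^sub>R za x) = (w x - z x) + k x *\<^sub>R za x"
        by simp
      also have "\<dots> \<in> span ?E'"
        using z(2)[OF that] sub by (intro span_add span_scale zaE) auto
      finally show "w x - (z x - k x *\<^sub>R za x) \<in> span ?E'" .
      note bil = B[OF x(2)]
      have lin: "linear (B x (z x - k x *\<^sub>R za x))"
        using bil by (auto simp: bilinear_def)
      have 0: "B x (z x - k x *\<^sub>R za x) v = 0" if "v \<in> span (?E x)" for v
        using that z(3)[OF \<open>x \<in> T\<close>] za(3)[OF x(1)]
        by (simp add: bilinear_lsub[OF bil] bilinear_lmul[OF bil])
      have "B x (z x - k x *\<^sub>R za x) (za x) = 0"
        using x(3) by (simp add: bilinear_lsub[OF bil] bilinear_lmul[OF bil] k_def b_def)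
      then have "B x (z x - k x *\<^sub>R za x) (e a x) = 0"
        using 0[OF za(2)[OF x(1)]] by (simp add: linear_diff[OF lin])
      then have "B x (z x - k x *\<^sub>R za x) v = 0" if "v \<in> ?E'" for v
        using that 0[OF span_base[of v]] by auto
      then show "\<forall>v\<in>span ?E'. B x (z x - k x *\<^sub>R za x) v = 0"
        using linear_eq_0_on_span[OF lin] by metis
    qed
    with 1 show ?thesis
      by blast
  qed
  with \<open>open N'\<close> \<open>y \<in> N'\<close> N'(2) dim' show ?case
    by blast
qed

text \<open>For each fixed vector \<open>w\<close>, the component of \<open>w\<close> orthogonal to
  \<open>V x\<close> turns out to be locally constant in \<open>x\<close>. As \<open>V x\<close>
  consists of the \<open>w\<close> for which this component vanishes, it does not vary near
  \<open>y\<close>.\<close>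

lemma parallel_locally_constant:
  fixes V :: "'x::real_normed_vector \<Rightarrow> 'b::euclidean_space set"
  assumes S: "open S" "y \<in> S"
    and V: "\<And>x. x \<in> S \<Longrightarrow> subspace (V x)" "\<And>x. x \<in> S \<Longrightarrow> dim (V x) = card I"
    and e: "finite I" "dim ((\<lambda>i. e i y) ` I) = card I" "\<And>i. i \<in> I \<Longrightarrow> smooth_on S (e i)"
      "\<And>i x. i \<in> I \<Longrightarrow> x \<in> S \<Longrightarrow> e i x \<in> V x"
      "\<And>i x u. i \<in> I \<Longrightarrow> x \<in> S \<Longrightarrow> frechet_derivative (e i) (at x) u \<in> V x"
  shows "\<exists>N. open N \<and> y \<in> N \<and> N \<subseteq> S \<and> (\<forall>x\<in>N. V x = V y)"
proof -
  have bil: "bilinear ((\<bullet>) :: 'b \<Rightarrow> 'b \<Rightarrow> real)"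
    using bilinear_conv_bounded_bilinear bounded_bilinear_inner by blast
  have "\<exists>N. open N \<and> y \<in> N \<and> N \<subseteq> S \<and> (\<forall>x\<in>N. dim ((\<lambda>i. e i x) ` I) = card I) \<and>
    (\<forall>T w. open T \<longrightarrow> T \<subseteq> N \<longrightarrow> smooth_on T w \<longrightarrow>
      (\<exists>z. smooth_on T z \<and> (\<forall>x\<in>T. w x - z x \<in> span ((\<lambda>i. e i x) ` I) \<and>
        (\<forall>v\<in>span ((\<lambda>i. e i x) ` I). z x \<bullet> v = 0))))"
  proof (rule local_orthogonal_complement[where B = "\<lambda>x. (\<bullet>)"])
    show "smooth_on T (\<lambda>x. u x \<bullet> v x)" if "open T" "smooth_on T u" "smooth_on T v" for T u and v :: "'x \<Rightarrow> 'b"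
      by (rule smooth_on_bounded_bilinear[OF bounded_bilinear_inner that])
  qed (use S bil e in auto)
  then obtain N where N: "open N" "y \<in> N" "N \<subseteq> S" "\<And>x. x \<in> N \<Longrightarrow> dim ((\<lambda>i. e i x) ` I) = card I"
    and NT: "\<forall>T w. open T \<longrightarrow> T \<subseteq> N \<longrightarrow> smooth_on T w \<longrightarrow>
      (\<exists>z. smooth_on T z \<and> (\<forall>x\<in>T. w x - z x \<in> span ((\<lambda>i. e i x) ` I) \<and>
        (\<forall>v\<in>span ((\<lambda>i. e i x) ` I). z x \<bullet> v = 0)))"
    by auto
  note NZ = NT[rule_format, OF N(1) order_refl]
  \<comment> \<open>The \<open>e i\<close> remain independent on \<open>N\<close> and lie in
    \<open>V x\<close>, which has dimension \<open>card I\<close>, so they span it.\<close>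
  have span_e: "span ((\<lambda>i. e i x) ` I) = V x" if "x \<in> N" for x
  proof -
    have "x \<in> S"
      using that N by auto
    moreover have "span ((\<lambda>i. e i x) ` I) \<subseteq> V x"
      using e(4) \<open>x \<in> S\<close> V(1) by (intro span_minimal) auto
    ultimately show ?thesis
      using V that N(4) by (intro subspace_dim_equal) auto
  qed
  with NZ[OF smooth_on_const[OF N(1)]] have "\<forall>w. \<exists>z. smooth_on N z \<and> (\<forall>x\<in>N. w - z x \<in> V x \<and> (\<forall>v\<in>V x. z x \<bullet> v = 0))"
    by simp
  then obtain z where z: "\<And>w. smooth_on N (z w)" "\<And>w x. x \<in> N \<Longrightarrow> w - z w x \<in> V x"
    "\<And>w x v. x \<in> N \<Longrightarrow> v \<in> V x \<Longrightarrow> z w x \<bullet> v = 0"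
    by metis
  txt \<open>\<open>z w\<close> is the component of the constant vector \<open>w\<close> orthogonal to \<open>V\<close>.  Its derivative is
    orthogonal to \<open>V\<close>, as \<open>V\<close> is parallel, and to every \<open>z w'\<close>, hence zero.\<close>
  let ?D = "\<lambda>w x. frechet_derivative (z w) (at x)"
  have dz: "(z w has_derivative ?D w x) (at x)" if "x \<in> N" for w x
    by (rule smooth_on_has_derivative[OF z(1) that])
  have der0: "d = (\<lambda>u. 0)" if "(h has_derivative d) (at x)" "x \<in> N" "\<And>x. x \<in> N \<Longrightarrow> h x = 0"
    for h :: "'x \<Rightarrow> real" and d x
  proof -
    have "((\<lambda>x. 0) has_derivative d) (at x)"
      using has_derivative_transform_within_open[OF that(1) N(1) that(2), of "\<lambda>x. 0"] that(3) by simp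
    then show ?thesis
      using has_derivative_unique[OF _ has_derivative_const] by blast
  qed
  \<comment> \<open>Differentiate the orthogonality of \<open>z w x\<close> and
    \<open>e i x\<close>. The term with the derivative of \<open>e i\<close> drops out, because that
    derivative lies in \<open>V x\<close>.\<close>
  have perp: "?D w x u \<bullet> v = 0" if "x \<in> N" "v \<in> V x" for w x u v
  proof -
    have "?D w x u \<bullet> e i x = 0" if "i \<in> I" for i
    proof -
      have "x \<in> S"
        using \<open>x \<in> N\<close> N by auto
      have de: "(e i has_derivative frechet_derivative (e i) (at x)) (at x)"
        by (rule smooth_on_has_derivative[OF e(3)[OF that] \<open>x \<in> S\<close>])
      have "(\<lambda>u. z w x \<bullet> frechet_derivative (e i) (at x) u + ?D w x u \<bullet> e i x) = (\<lambda>u. 0)"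
        using N(3) e(4)[OF that] z(3)
        by (intro der0[OF has_derivative_inner[OF dz[OF \<open>x \<in> N\<close>] de] \<open>x \<in> N\<close>]) auto
      then show ?thesis
        using z(3)[OF \<open>x \<in> N\<close> e(5)[OF that \<open>x \<in> S\<close>]] by (metis add_0)
    qed
    moreover have "v \<in> span ((\<lambda>i. e i x) ` I)"
      using span_e \<open>x \<in> N\<close> \<open>v \<in> V x\<close> by simp
    moreover have "linear (\<lambda>v. ?D w x u \<bullet> v)"
      by (intro bounded_linear.linear bounded_linear_inner_right)
    ultimately show ?thesis
      using linear_eq_0_on_span[of "\<lambda>v. ?D w x u \<bullet> v" "(\<lambda>i. e i x) ` I" v] by auto
  qed
  have "?D w x u = 0" if "x \<in> N" for w x u
  proof -
    have "?D w x u \<bullet> z w' x = 0" for w'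
    proof -
      \<comment> \<open>Differentiate the orthogonality of \<open>w - z w x\<close>, which lies in
        \<open>V x\<close>, and \<open>z w' x\<close>. The first term vanishes by
        \<open>perp\<close>, so the derivative of \<open>z w\<close> is orthogonal to every
        \<open>z w' x\<close>.\<close>
      have "(\<lambda>u. (w - z w x) \<bullet> ?D w' x u + (0 - ?D w x u) \<bullet> z w' x) = (\<lambda>u. 0)"
      proof (rule der0[OF has_derivative_inner[OF has_derivative_diff[OF has_derivative_const
              dz[OF that]] dz[OF that]] that])
        show "(w - z w x) \<bullet> z w' x = 0" if "x \<in> N" for x
          using z(3)[OF that z(2)[OF that]] by (simp add: inner_commute)
      qed
      then have "(w - z w x) \<bullet> ?D w' x u + (0 - ?D w x u) \<bullet> z w' x = 0"
        by metis
      then show ?thesis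
        using perp[OF that z(2)[OF that]] by (simp add: inner_commute)
    qed
    \<comment> \<open>Take the derivative itself as \<open>w'\<close>: it is the sum of a vector of
      \<open>V x\<close> and of \<open>z w' x\<close>, and it is orthogonal to both.\<close>
    then have "?D w x u \<bullet> ?D w x u = 0"
      using perp[OF that z(2)[OF that, of "?D w x u"], of w u]
      by (metis inner_diff_right right_minus_eq)
    then show ?thesis
      by simp
  qed
  then have D0: "(z w has_derivative (\<lambda>u. 0)) (at x)" if "x \<in> N" for w x
    using dz[OF that, of w] that by (metis ext)
  \<comment> \<open>On a ball, which is convex, the vanishing derivative makes \<open>z w\<close>
    constant.\<close>
  obtain r where r: "r > 0" "ball y r \<subseteq> N"
    using N(1,2) by (metis open_contains_ball)
  have const: "z w x = z w y" if "x \<in> ball y r" for w x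
  proof -
    have "\<exists>c. \<forall>x\<in>ball y r. z w x = c"
    proof (rule has_derivative_zero_constant)
      show "(z w has_derivative (\<lambda>u. 0)) (at x within ball y r)" if "x \<in> ball y r" for x
        using that r(2) by (intro has_derivative_at_withinI[OF D0]) auto
    qed simp
    then show ?thesis
      using that r by (metis centre_in_ball)
  qed
  have V_iff: "w \<in> V x \<longleftrightarrow> z w x = 0" if "x \<in> N" for w x
  proof
    assume "w \<in> V x"
    moreover have "z w x = w - (w - z w x)"
      by simp
    ultimately have "z w x \<in> V x"
      using subspace_diff[OF V(1)] z(2)[OF that] N(3) that by (metis subsetD)
    then show "z w x = 0"
      using z(3)[OF that] by (metis inner_eq_zero_iff)
  next
    assume "z w x = 0"
    then show "w \<in> V x"
      using z(2)[OF that, of w] by simp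
  qed
  have "V x = V y" if "x \<in> ball y r" for x
  proof -
    have "x \<in> N"
      using that r(2) by auto
    then show ?thesis
      by (intro set_eqI) (simp add: V_iff N(2) const[OF that])
  qed
  moreover have "ball y r \<subseteq> S" "y \<in> ball y r"
    using r N(3) by auto
  ultimately show ?thesis
    using open_ball by metis
qed


subsection \<open>Charts\<close>

context
  fixes A :: "('a::topological_space, 'm::finite) chart set"
  assumes atlas: "smooth_atlas A"
begin

lemma chart_exists: "\<exists>c\<in>A. p \<in> fst c"
  using atlas by (auto simp: smooth_atlas_def)

lemma open_chart: "c \<in> A \<Longrightarrow> open (fst c)"
  using atlas by (auto simp: smooth_atlas_def)

lemma chart_inverse:
  assumes "c \<in> A" "p \<in> fst c"
  shows "inv_into (fst c) (snd c) (snd c p) = p"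
  using atlas assms by (auto simp: smooth_atlas_def intro: homeomorphism_apply1)

lemma in_chart_apply: "c \<in> A \<Longrightarrow> p \<in> fst c \<Longrightarrow> in_chart c s (snd c p) = s p"
  by (simp add: in_chart_def chart_inverse)

lemma open_chart_image:
  assumes "c \<in> A" "open W"
  shows "open (snd c ` (fst c \<inter> W))"
proof -
  have "open (snd c ` fst c)" "continuous_on (snd c ` fst c) (inv_into (fst c) (snd c))"
    using atlas assms(1) by (auto simp: smooth_atlas_def homeomorphism_def)
  moreover have "snd c ` (fst c \<inter> W) = snd c ` fst c \<inter> inv_into (fst c) (snd c) -` W"
    using chart_inverse[OF assms(1)] by auto
  ultimately show ?thesis
    using continuous_open_preimage assms(2) by metis
qed

lemma open_chart_preimage:
  assumes "c \<in> A" "open N"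
  shows "open {q \<in> fst c. snd c q \<in> N}"
proof -
  have "continuous_on (fst c) (snd c)"
    using atlas assms(1) by (auto simp: smooth_atlas_def homeomorphism_def)
  then have "open (fst c \<inter> snd c -` N)"
    by (rule continuous_open_preimage[OF _ open_chart[OF assms(1)] assms(2)])
  moreover have "{q \<in> fst c. snd c q \<in> N} = fst c \<inter> snd c -` N"
    by auto
  ultimately show ?thesis
    by simp
qed

lemma smooth_along_has_derivative:
  assumes "smooth_along A W s" "c \<in> A" "p \<in> fst c" "p \<in> W"
  shows "(in_chart c s has_derivative dir_deriv c s p) (at (snd c p))"
proof -
  have "(in_chart c s has_derivative frechet_derivative (in_chart c s) (at (snd c p))) (at (snd c p))"
    using assms by (intro smooth_on_has_derivative[of "snd c ` (fst c \<inter> W)"]) (auto simp: smooth_along_def)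
  moreover have "dir_deriv c s p = frechet_derivative (in_chart c s) (at (snd c p))"
    by (simp add: dir_deriv_def fun_eq_iff)
  ultimately show ?thesis
    by simp
qed

lemma smooth_along_subset: "smooth_along A W s \<Longrightarrow> W' \<subseteq> W \<Longrightarrow> smooth_along A W' s"
  unfolding smooth_along_def by (meson Int_mono image_mono order_refl smooth_on_subset)

lemma transition:
  assumes c: "c \<in> A" "c' \<in> A" "p \<in> fst c" "p \<in> fst c'"
  shows "in_chart c (snd c') (snd c p) = snd c' p"
    and "in_chart c s (snd c p) = in_chart c' s (in_chart c (snd c') (snd c p))"
  using c by (simp_all add: in_chart_apply)

lemma smooth_transition:
  assumes "c \<in> A" "c' \<in> A" "W \<subseteq> fst c'"
  shows "smooth_on (snd c ` (fst c \<inter> W)) (in_chart c (snd c'))"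
proof -
  have "smooth_along A (fst c') (snd c')"
    using atlas assms(2) by (simp add: smooth_atlas_def)
  from smooth_along_subset[OF this assms(3)] show ?thesis
    using assms(1) by (simp add: smooth_along_def)
qed

text \<open>One chart suffices, since in any other chart \<open>s\<close> is composed with a smooth
  transition map.\<close>

lemma smooth_along_chartI:
  fixes s :: "'a \<Rightarrow> 'b::real_normed_vector"
  assumes c': "c' \<in> A" "open W" "W \<subseteq> fst c'" "smooth_on (snd c' ` W) (in_chart c' s)"
  shows "smooth_along A W s"
  unfolding smooth_along_def
proof
  fix c
  assume c: "c \<in> A"
  let ?S = "snd c ` (fst c \<inter> W)"
  have S: "open ?S" "open (snd c' ` W)"
    using open_chart_image[OF c c'(2)] open_chart_image[OF c'(1,2)] c'(3) by (simp_all add: Int_absorb1)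
  have "in_chart c (snd c') x \<in> snd c' ` W" if "x \<in> ?S" for x
    using that transition(1)[OF c c'(1)] c'(3) by auto
  then have "smooth_on ?S (\<lambda>x. in_chart c' s (in_chart c (snd c') x))"
    using smooth_on_compose[OF S _ smooth_transition[OF c c'(1,3)] c'(4)] by simp
  moreover have "in_chart c s x = in_chart c' s (in_chart c (snd c') x)" if "x \<in> ?S" for x
    using that transition(2)[OF c c'(1), of _ s] c'(3) by auto
  ultimately show "smooth_on ?S (in_chart c s)"
    using smooth_on_cong[OF S(1)] by metis
qed

lemma dir_deriv_chain:
  assumes s: "smooth_along A W s" "p \<in> W" and c: "c \<in> A" "c' \<in> A" "p \<in> fst c" "p \<in> fst c'"
  shows "dir_deriv c s p u = dir_deriv c' s p (dir_deriv c (snd c') p u)"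
proof -
  have "smooth_along A (fst c') (snd c')"
    using atlas c(2) by (simp add: smooth_atlas_def)
  note d = smooth_along_has_derivative[OF this c(1,3,4)]
  have "(in_chart c' s has_derivative dir_deriv c' s p) (at (in_chart c (snd c') (snd c p)))"
    using smooth_along_has_derivative[OF s(1) c(2,4) s(2)] transition(1)[OF c] by simp
  from diff_chain_at[OF d this]
  have "((\<lambda>x. in_chart c' s (in_chart c (snd c') x)) has_derivative
      (\<lambda>u. dir_deriv c' s p (dir_deriv c (snd c') p u))) (at (snd c p))"
    by (simp add: comp_def)
  moreover have "open (snd c ` (fst c \<inter> fst c'))" "snd c p \<in> snd c ` (fst c \<inter> fst c')"
    using open_chart_image[OF c(1) open_chart[OF c(2)]] c by auto
  moreover have "in_chart c' s (in_chart c (snd c') x) = in_chart c s x"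
    if "x \<in> snd c ` (fst c \<inter> fst c')" for x
    using that transition(2)[OF c(1,2), of _ s] by auto
  ultimately have "(in_chart c s has_derivative
      (\<lambda>u. dir_deriv c' s p (dir_deriv c (snd c') p u))) (at (snd c p))"
    by (rule has_derivative_transform_within_open)
  then have "(\<lambda>u. dir_deriv c' s p (dir_deriv c (snd c') p u)) = dir_deriv c s p"
    using smooth_along_has_derivative[OF s(1) c(1,3) s(2)] by (rule has_derivative_unique)
  then show ?thesis
    by metis
qed

text \<open>By connectedness it is enough that \<open>V\<close> is locally constant. The generators
  only have to span pointwise: a basis of \<open>V p\<close> is picked among their values, the
  finitely many domains are intersected with a chart domain, and
  \<open>parallel_locally_constant\<close> applies in its coordinates.\<close>

lemma parallel_constant:
  fixes V :: "'a \<Rightarrow> 'b::euclidean_space set"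
  assumes conn: "connected (UNIV :: 'a set)"
    and V: "\<And>p. subspace (V p)" "\<And>p. dim (V p) = d"
    and gen: "\<And>p. V p \<subseteq> span {s p |s W. open W \<and> p \<in> W \<and> smooth_along A W s \<and>
      (\<forall>q\<in>W. s q \<in> V q) \<and> (\<forall>c\<in>A. \<forall>q\<in>fst c \<inter> W. \<forall>u. dir_deriv c s q u \<in> V q)}"
  shows "V p = V q"
proof (rule connected_local_const[OF conn UNIV_I UNIV_I, rule_format])
  fix p
  define G where "G = {s p |s W. open W \<and> p \<in> W \<and> smooth_along A W s \<and>
      (\<forall>q\<in>W. s q \<in> V q) \<and> (\<forall>c\<in>A. \<forall>q\<in>fst c \<inter> W. \<forall>u. dir_deriv c s q u \<in> V q)}"
  have "V p \<subseteq> span G" "G \<subseteq> V p"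
    using gen[of p] by (auto simp: G_def)
  then have "span G = V p"
    using V(1) by (metis span_minimal subset_antisym)
  obtain I where I: "I \<subseteq> G" "independent I" "G \<subseteq> span I" "card I = dim G"
    using basis_exists by blast
  have card: "card I = d"
    using I(4) \<open>span G = V p\<close> V(2) by (metis dim_span)
  have finI: "finite I"
    using I(2) by (rule independent_imp_finite)
  have "\<forall>b\<in>I. \<exists>s W. b = s p \<and> open W \<and> p \<in> W \<and> smooth_along A W s \<and>
      (\<forall>q\<in>W. s q \<in> V q) \<and> (\<forall>c\<in>A. \<forall>q\<in>fst c \<inter> W. \<forall>u. dir_deriv c s q u \<in> V q)"
    using I(1) by (auto simp: G_def)
  from bchoice[OF this] obtain s where "\<forall>b\<in>I. \<exists>W. b = s b p \<and> open W \<and> p \<in> W \<and> smooth_along A W (s b) \<and>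
      (\<forall>q\<in>W. s b q \<in> V q) \<and> (\<forall>c\<in>A. \<forall>q\<in>fst c \<inter> W. \<forall>u. dir_deriv c (s b) q u \<in> V q)" ..
  from bchoice[OF this] obtain W where sW: "\<And>b. b \<in> I \<Longrightarrow> b = s b p \<and> open (W b) \<and> p \<in> W b \<and>
      smooth_along A (W b) (s b) \<and> (\<forall>q\<in>W b. s b q \<in> V q) \<and>
      (\<forall>c\<in>A. \<forall>q\<in>fst c \<inter> W b. \<forall>u. dir_deriv c (s b) q u \<in> V q)"
    by metis
  have s: "s b p = b" if "b \<in> I" for b
    using sW[OF that] by simp
  obtain c where c: "c \<in> A" "p \<in> fst c"
    using chart_exists by blast
  let ?W = "\<Inter> (W ` I)"
  let ?S = "snd c ` (fst c \<inter> ?W)"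
  have S: "open ?S" "snd c p \<in> ?S"
    using open_chart_image[OF c(1), of ?W] finI sW c(2) by auto
  define V' where "V' x = V (inv_into (fst c) (snd c) x)" for x
  have V': "V' (snd c q) = V q" if "q \<in> fst c" for q
    using chart_inverse[OF c(1) that] by (simp add: V'_def)
  have "\<exists>N. open N \<and> snd c p \<in> N \<and> N \<subseteq> ?S \<and> (\<forall>x\<in>N. V' x = V' (snd c p))"
  proof (rule parallel_locally_constant[OF S])
    show "subspace (V' x)" "dim (V' x) = card I" for x
      using V card by (simp_all add: V'_def)
    have "(\<lambda>b. in_chart c (s b) (snd c p)) ` I = I"
      using s by (simp add: in_chart_apply[OF c])
    then show "dim ((\<lambda>b. in_chart c (s b) (snd c p)) ` I) = card I"
      using dim_eq_card_independent[OF I(2)] by simp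
  next
    fix b
    assume b: "b \<in> I"
    show "smooth_on ?S (in_chart c (s b))"
    proof (rule smooth_on_subset)
      show "smooth_on (snd c ` (fst c \<inter> W b)) (in_chart c (s b))"
        using sW[OF b] c(1) by (simp add: smooth_along_def)
    qed (use b in auto)
    fix x
    assume "x \<in> ?S"
    then obtain q where q: "x = snd c q" "q \<in> fst c" "q \<in> W b"
      using b by auto
    then show "in_chart c (s b) x \<in> V' x"
      using sW[OF b] by (simp add: in_chart_apply[OF c(1)] V')
    show "frechet_derivative (in_chart c (s b)) (at x) u \<in> V' x" for u
      using sW[OF b] c(1) q by (simp add: V' flip: dir_deriv_def)
  qed (rule finI)
  then obtain N where N: "open N" "snd c p \<in> N" "N \<subseteq> ?S" "\<And>x. x \<in> N \<Longrightarrow> V' x = V' (snd c p)"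
    by metis
  let ?U = "{q \<in> fst c. snd c q \<in> N}"
  have "open ?U"
    by (rule open_chart_preimage[OF c(1) N(1)])
  moreover have "p \<in> ?U"
    using c(2) N(2) by simp
  moreover have "V p = V q" if "q \<in> ?U" for q
    using that N(4)[of "snd c q"] V' c(2) by simp
  ultimately show "\<forall>\<^sub>F q in at p within UNIV. V p = V q"
    unfolding eventually_at_topological by metis
qed

end


subsection \<open>Immersions into the warped product\<close>

lemma wmetric_add:
  "wmetric \<epsilon> \<rho> q (v + w) z = wmetric \<epsilon> \<rho> q v z + wmetric \<epsilon> \<rho> q w z"
  "wmetric \<epsilon> \<rho> q z (v + w) = wmetric \<epsilon> \<rho> q z v + wmetric \<epsilon> \<rho> q z w"
  by (simp_all add: wmetric_def eform_linear algebra_simps)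

lemma wmetric_scaleR:
  "wmetric \<epsilon> \<rho> q (a *\<^sub>R v) z = a * wmetric \<epsilon> \<rho> q v z"
  "wmetric \<epsilon> \<rho> q z (a *\<^sub>R v) = a * wmetric \<epsilon> \<rho> q z v"
  by (simp_all add: wmetric_def eform_linear algebra_simps)

lemma bilinear_wmetric: "bilinear (wmetric \<epsilon> \<rho> q)"
  unfolding bilinear_def
  by (intro conjI allI linearI) (simp_all only: wmetric_add wmetric_scaleR real_scaleR_def)

lemma subspace_wtangent: "subspace (wtangent \<epsilon> q)"
  unfolding subspace_def wtangent_def
  by (auto simp: eform_linear) (simp add: eform_def)

lemma smooth_on_eform:
  "open S \<Longrightarrow> smooth_on S v \<Longrightarrow> smooth_on S w \<Longrightarrow> smooth_on S (\<lambda>x. eform \<epsilon> (v x) (w x))"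
  by (rule smooth_on_bounded_bilinear[OF bounded_bilinear_eform])

lemma smooth_on_fst: "open S \<Longrightarrow> smooth_on S v \<Longrightarrow> smooth_on S (\<lambda>x. fst (v x))"
  by (intro smooth_on_bounded_linear[OF _ _ bounded_linear_fst])

lemma smooth_on_snd: "open S \<Longrightarrow> smooth_on S v \<Longrightarrow> smooth_on S (\<lambda>x. snd (v x))"
  by (intro smooth_on_bounded_linear[OF _ _ bounded_linear_snd])

lemma smooth_on_wmetric:
  assumes "smooth_on UNIV \<rho>" "open S" "smooth_on S F" "smooth_on S v" "smooth_on S w"
  shows "smooth_on S (\<lambda>x. wmetric \<epsilon> \<rho> (F x) (v x) (w x))"
proof -
  note fs = smooth_on_fst[OF assms(2)] smooth_on_snd[OF assms(2)]
  have r: "smooth_on S (\<lambda>x. \<rho> (fst (F x)))"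
    using smooth_on_compose[OF assms(2) open_UNIV _ fs(1)[OF assms(3)] assms(1)] by simp
  show ?thesis
    unfolding wmetric_def power2_eq_square
    by (intro smooth_on_add smooth_on_mult smooth_on_eform fs r assms(2-))
qed

lemma smooth_on_wchristoffel:
  assumes "smooth_on UNIV \<rho>" "\<And>t. \<rho> t > 0" "open S" "smooth_on S F" "smooth_on S v" "smooth_on S w"
  shows "smooth_on S (\<lambda>x. wchristoffel \<epsilon> \<rho> (F x) (v x) (w x))"
proof -
  note fs = smooth_on_fst[OF assms(3)] smooth_on_snd[OF assms(3)]
  have r: "smooth_on S (\<lambda>x. \<rho> (fst (F x)))" "smooth_on S (\<lambda>x. deriv \<rho> (fst (F x)))"
    using smooth_on_compose[OF assms(3) open_UNIV _ fs(1)[OF assms(4)] assms(1)]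
      smooth_on_compose[OF assms(3) open_UNIV _ fs(1)[OF assms(4)] smooth_on_deriv[OF open_UNIV assms(1)]]
    by simp_all
  have nz: "\<rho> t \<noteq> 0" for t
    using assms(2)[of t] by simp
  \<comment> \<open>The negation is rewritten as a product with \<open>- 1\<close>, so that the
    rules for products and constants cover it.\<close>
  have "- (a::real) = (- 1) * a" for a
    by simp
  then have *: "wchristoffel \<epsilon> \<rho> q v w =
     (((- 1) * \<rho> (fst q)) * deriv \<rho> (fst q) * eform \<epsilon> (snd v) (snd w),
      (deriv \<rho> (fst q) / \<rho> (fst q)) *\<^sub>R (fst v *\<^sub>R snd w + fst w *\<^sub>R snd v)
        + (\<epsilon> * eform \<epsilon> (snd v) (snd w)) *\<^sub>R snd q)" for q v and w :: "'b ambient"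
    unfolding wchristoffel_def by metis
  show ?thesis
    unfolding *
    by (intro smooth_on_Pair smooth_on_add smooth_on_mult smooth_on_scaleR smooth_on_divide
        smooth_on_eform smooth_on_const fs r assms(3-) nz)
qed

section \<open>Tangent and normal spaces of an isometric immersion\<close>

locale warped_immersion =
  fixes A :: "('a::topological_space, 'm::finite) chart set"
    and g :: "('a, 'm) chart \<Rightarrow> 'a \<Rightarrow> real ^ 'm \<Rightarrow> real ^ 'm \<Rightarrow> real"
    and f :: "'a \<Rightarrow> 'n::finite ambient"
    and \<epsilon> :: real and \<rho> :: "real \<Rightarrow> real"
  assumes eps: "\<epsilon> = 1 \<or> \<epsilon> = -1"
    and rho_smooth: "smooth_on UNIV \<rho>"
    and rho_pos: "\<And>t. \<rho> t > 0"
    and atlas: "smooth_atlas A"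
    and metric: "riemannian_metric A g"
    and immersion: "isometric_immersion \<epsilon> \<rho> A g f"
begin

abbreviation "TM p \<equiv> tangent_image A f p"
abbreviation "NM p \<equiv> normal_space \<epsilon> \<rho> A f p"
abbreviation "nor p w \<equiv> normal_part \<epsilon> \<rho> A f p w"
abbreviation "cov c \<xi> p u \<equiv> cov_deriv \<epsilon> \<rho> c f \<xi> p u"
abbreviation "sff c p u v \<equiv> second_ff \<epsilon> \<rho> A c f p u v"

lemma f_smooth: "smooth_along A UNIV f"
  using immersion by (simp add: isometric_immersion_def)

lemma eform_f: "eform \<epsilon> (snd (f p)) (snd (f p)) = \<epsilon>"
  using immersion by (auto simp: isometric_immersion_def Q_def image_subset_iff mem_Times_iff)

lemma f_has_derivative:
  "c \<in> A \<Longrightarrow> p \<in> fst c \<Longrightarrow> (in_chart c f has_derivative dir_deriv c f p) (at (snd c p))"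
  by (rule smooth_along_has_derivative[OF atlas f_smooth]) auto

lemma linear_df: "c \<in> A \<Longrightarrow> p \<in> fst c \<Longrightarrow> linear (dir_deriv c f p)"
  by (rule has_derivative_linear[OF f_has_derivative])

lemma inj_df: "c \<in> A \<Longrightarrow> p \<in> fst c \<Longrightarrow> inj (dir_deriv c f p)"
  using immersion by (simp add: isometric_immersion_def)

lemma TM_eq:
  assumes "c \<in> A" "p \<in> fst c"
  shows "TM p = range (dir_deriv c f p)"
proof
  show "TM p \<subseteq> range (dir_deriv c f p)"
  proof
    fix w
    assume "w \<in> TM p"
    then obtain c' u where "c' \<in> A" "p \<in> fst c'" "w = dir_deriv c' f p u"
      by (auto simp: tangent_image_def)
    then show "w \<in> range (dir_deriv c f p)"
      using dir_deriv_chain[OF atlas f_smooth UNIV_I _ assms(1) _ assms(2), of c' u] by simp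
  qed
  show "range (dir_deriv c f p) \<subseteq> TM p"
    unfolding tangent_image_def using assms by blast
qed

lemma subspace_TM: "subspace (TM p)"
proof -
  obtain c where "c \<in> A" "p \<in> fst c"
    using chart_exists[OF atlas] by metis
  then show ?thesis
    using linear_subspace_image[OF linear_df subspace_UNIV] by (simp add: TM_eq)
qed

lemma dim_TM: "dim (TM p) = CARD('m)"
proof -
  obtain c where c: "c \<in> A" "p \<in> fst c"
    using chart_exists[OF atlas] by metis
  have "dim (dir_deriv c f p ` UNIV) = dim (UNIV :: (real ^ 'm) set)"
    using linear_df[OF c] inj_df[OF c] by (intro dim_image_eq) auto
  then show ?thesis
    using c by (simp add: TM_eq)
qed

text \<open>Positivity is inherited from \<open>g\<close> through the isometry, although
  \<open>wmetric\<close> is indefinite on the whole space if \<open>\<epsilon> = -1\<close>.\<close>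

lemma TM_positive:
  assumes "w \<in> TM p" "w \<noteq> 0"
  shows "wmetric \<epsilon> \<rho> (f p) w w > 0"
proof -
  obtain c u where c: "c \<in> A" "p \<in> fst c" and w: "w = dir_deriv c f p u"
    using assms(1) by (auto simp: tangent_image_def)
  have "u \<noteq> 0"
    using assms(2) w linear_0[OF linear_df[OF c]] by auto
  then have "g c p u u > 0"
    using conjunct1[OF metric[unfolded riemannian_metric_def]] c by metis
  moreover have "wmetric \<epsilon> \<rho> (f p) w w = g c p u u"
    using immersion c by (simp add: isometric_immersion_def w)
  ultimately show ?thesis
    by simp
qed

lemma subspace_NM: "subspace (NM p)"
  using subspace_wtangent[of \<epsilon> "f p"]
  by (auto simp: normal_space_def subspace_def wmetric_add wmetric_scaleR)
    (simp add: wmetric_def eform_def)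

lemma TM_inter_NM: "TM p \<inter> NM p = {0}"
proof
  show "TM p \<inter> NM p \<subseteq> {0}"
    using TM_positive[of _ p] by (force simp: normal_space_def)
  show "{0} \<subseteq> TM p \<inter> NM p"
    using subspace_0[OF subspace_TM] subspace_0[OF subspace_NM] by simp
qed

text \<open>Two candidates for the normal part differ by a vector of
  \<open>TM p \<inter> NM p\<close>, which is zero. Existence comes from the Gram-Schmidt argument
  in \<open>local_normal_part\<close>.\<close>

lemma normal_part_eqI:
  assumes "\<xi> \<in> NM p" "w - \<xi> \<in> TM p"
  shows "nor p w = \<xi>"
  unfolding normal_part_def
proof (rule the_equality)
  fix \<zeta>
  assume \<zeta>: "\<zeta> \<in> NM p \<and> w - \<zeta> \<in> TM p"
  then have "\<zeta> - \<xi> \<in> NM p"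
    using assms(1) subspace_diff[OF subspace_NM] by metis
  moreover have "(w - \<xi>) - (w - \<zeta>) \<in> TM p"
    using \<zeta> assms(2) subspace_diff[OF subspace_TM] by metis
  then have "\<zeta> - \<xi> \<in> TM p"
    by simp
  ultimately have "\<zeta> - \<xi> \<in> TM p \<inter> NM p"
    by simp
  then show "\<zeta> = \<xi>"
    unfolding TM_inter_NM by simp
qed (use assms in simp)

text \<open>The product rule for a constant function. With \<open>f\<close> in both places it makes
  derivatives of \<open>f\<close> tangent to the warped product; with \<open>f\<close> and a tangent
  field it determines the radial part of the derivative of that field.\<close>

lemma eform_dir_deriv:
  assumes c: "c \<in> A" "p \<in> fst c" "p \<in> W" and W: "open W"
    and v: "smooth_along A W v" and w: "smooth_along A W w"
    and const: "\<And>q. q \<in> W \<Longrightarrow> eform \<epsilon> (snd (v q)) (snd (w q)) = k"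
  shows "eform \<epsilon> (snd (v p)) (snd (dir_deriv c w p u)) + eform \<epsilon> (snd (dir_deriv c v p u)) (snd (w p)) = 0"
proof -
  let ?h = "\<lambda>x. eform \<epsilon> (snd (in_chart c v x)) (snd (in_chart c w x))"
  let ?d = "\<lambda>u. eform \<epsilon> (snd (v p)) (snd (dir_deriv c w p u)) + eform \<epsilon> (snd (dir_deriv c v p u)) (snd (w p))"
  have "(?h has_derivative ?d) (at (snd c p))"
    using bounded_bilinear.FDERIV[OF bounded_bilinear_eform
        bounded_linear.has_derivative[OF bounded_linear_snd smooth_along_has_derivative[OF atlas v c]]
        bounded_linear.has_derivative[OF bounded_linear_snd smooth_along_has_derivative[OF atlas w c]]]
    by (simp add: in_chart_apply[OF atlas c(1,2)])
  moreover have "open (snd c ` (fst c \<inter> W))" "snd c p \<in> snd c ` (fst c \<inter> W)"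
    using open_chart_image[OF atlas c(1) W] c by auto
  moreover have "?h x = k" if "x \<in> snd c ` (fst c \<inter> W)" for x
    using that const by (auto simp: in_chart_apply[OF atlas c(1)])
  ultimately have "((\<lambda>x. k) has_derivative ?d) (at (snd c p))"
    by (rule has_derivative_transform_within_open)
  then have "?d = (\<lambda>u. 0)"
    by (rule has_derivative_unique[OF _ has_derivative_const])
  from fun_cong[OF this, of u] show ?thesis
    by simp
qed

lemma eform_f_df:
  assumes "c \<in> A" "p \<in> fst c"
  shows "eform \<epsilon> (snd (f p)) (snd (dir_deriv c f p u)) = 0"
  using eform_dir_deriv[OF assms UNIV_I open_UNIV f_smooth f_smooth eform_f, of u]
  by (simp add: eform_sym)

lemma TM_wtangent: "TM p \<subseteq> wtangent \<epsilon> (f p)"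
  using eform_f_df by (auto simp: tangent_image_def wtangent_def)

text \<open>Differentiating the tangency of \<open>\<xi>\<close> shows that its flat derivative has
  radial part \<open>- eform \<epsilon> (snd (dir_deriv c f p u)) (snd (\<xi> p))\<close>. The last
  term of \<open>wchristoffel\<close> cancels it, as the square of \<open>\<epsilon>\<close> is
  1.\<close>

lemma cov_deriv_wtangent:
  assumes c: "c \<in> A" "p \<in> fst c" "p \<in> W" and W: "open W"
    and \<xi>: "smooth_along A W \<xi>" "\<And>q. q \<in> W \<Longrightarrow> \<xi> q \<in> wtangent \<epsilon> (f q)"
  shows "cov c \<xi> p u \<in> wtangent \<epsilon> (f p)"
proof -
  have "smooth_along A W f"
    using smooth_along_subset[OF atlas f_smooth] by simp
  from eform_dir_deriv[OF c W this \<xi>(1), of 0 u]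
  have "eform \<epsilon> (snd (f p)) (snd (dir_deriv c \<xi> p u)) = - eform \<epsilon> (snd (dir_deriv c f p u)) (snd (\<xi> p))"
    using \<xi>(2) by (simp add: wtangent_def)
  moreover have "eform \<epsilon> (snd (f p)) (snd (\<xi> p)) = 0"
    using \<xi>(2)[OF c(3)] by (simp add: wtangent_def)
  ultimately show ?thesis
    using eps eform_f_df[OF c(1,2), of u] eform_f[of p]
    by (auto simp: wtangent_def cov_deriv_def wchristoffel_def eform_linear)
qed

text \<open>\<open>dir_deriv c\<close> uses the coordinates of \<open>c\<close>, hence the
  restriction to \<open>fst c\<close>. Smoothness in \<open>c\<close> itself passes to all charts by
  \<open>smooth_along_chartI\<close>.\<close>

lemma smooth_along_dir_deriv:
  assumes c: "c \<in> A" and W: "open W" and s: "smooth_along A W s"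
  shows "smooth_along A (fst c \<inter> W) (\<lambda>q. dir_deriv c s q u)"
proof (rule smooth_along_chartI[OF atlas c])
  let ?S = "snd c ` (fst c \<inter> W)"
  have 1: "smooth_on ?S (\<lambda>x. frechet_derivative (in_chart c s) (at x) u)"
    using s c by (intro smooth_on_frechet_derivative) (simp add: smooth_along_def)
  have 2: "frechet_derivative (in_chart c s) (at x) u = in_chart c (\<lambda>q. dir_deriv c s q u) x"
    if "x \<in> ?S" for x
    using that by (auto simp: in_chart_apply[OF atlas c] dir_deriv_def)
  show "smooth_on ?S (in_chart c (\<lambda>q. dir_deriv c s q u))"
    by (rule iffD1[OF smooth_on_cong[OF open_chart_image[OF atlas c W] 2] 1])
qed (use open_chart[OF atlas c] W in auto)

lemma smooth_along_cov_deriv: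
  assumes c: "c \<in> A" and W: "open W" and \<xi>: "smooth_along A W \<xi>"
  shows "smooth_along A (fst c \<inter> W) (\<lambda>q. cov c \<xi> q u)"
proof (rule smooth_along_chartI[OF atlas c])
  let ?S = "snd c ` (fst c \<inter> W)"
  have S: "open ?S"
    by (rule open_chart_image[OF atlas c W])
  have "smooth_on ?S (in_chart c s)" if "smooth_along A (fst c \<inter> W) s" for s :: "'a \<Rightarrow> 'n ambient"
    using that c by (auto simp: smooth_along_def Int_left_absorb)
  note sm = this[OF smooth_along_dir_deriv[OF c W \<xi>]] this[OF smooth_along_subset[OF atlas f_smooth subset_UNIV]]
    this[OF smooth_along_dir_deriv[OF c W smooth_along_subset[OF atlas f_smooth subset_UNIV]]]
    this[OF smooth_along_subset[OF atlas \<xi> Int_lower2]]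
  have "smooth_on ?S (\<lambda>x. in_chart c (\<lambda>q. dir_deriv c \<xi> q u) x + wchristoffel \<epsilon> \<rho> (in_chart c f x)
      (in_chart c (\<lambda>q. dir_deriv c f q u) x) (in_chart c \<xi> x))"
    by (rule smooth_on_add[OF S sm(1) smooth_on_wchristoffel[OF rho_smooth rho_pos S sm(2,3,4)]])
  moreover have "in_chart c (\<lambda>q. dir_deriv c \<xi> q u) x + wchristoffel \<epsilon> \<rho> (in_chart c f x)
      (in_chart c (\<lambda>q. dir_deriv c f q u) x) (in_chart c \<xi> x) = in_chart c (\<lambda>q. cov c \<xi> q u) x"
    for x
    by (simp add: cov_deriv_def in_chart_def)
  ultimately show "smooth_on ?S (in_chart c (\<lambda>q. cov c \<xi> q u))"
    by simp
qed (use open_chart[OF atlas c] W in auto)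

text \<open>The images of the coordinate fields under the differential of \<open>f\<close> form a
  smooth frame of \<open>TM\<close>, on which \<open>wmetric\<close> is positive. So
  \<open>local_orthogonal_complement\<close> yields the existence of the normal component together
  with its smooth dependence on the point.\<close>

lemma local_normal_part:
  assumes c: "c \<in> A" "p \<in> fst c" "p \<in> W" and W: "open W"
    and w: "smooth_along A W w" "\<And>q. q \<in> W \<Longrightarrow> w q \<in> wtangent \<epsilon> (f q)"
  shows "\<exists>T z. open T \<and> snd c p \<in> T \<and> T \<subseteq> snd c ` (fst c \<inter> W) \<and> smooth_on T z \<and>
    (\<forall>q\<in>fst c. snd c q \<in> T \<longrightarrow> z (snd c q) \<in> NM q \<and> w q - z (snd c q) \<in> TM q)"
proof -
  let ?S = "snd c ` (fst c \<inter> W)"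
  let ?e = "\<lambda>b x. frechet_derivative (in_chart c f) (at x) b"
  let ?B = "\<lambda>x. wmetric \<epsilon> \<rho> (in_chart c f x)"
  have S: "open ?S" "snd c p \<in> ?S"
    using open_chart_image[OF atlas c(1) W] c by auto
  have F: "smooth_on ?S (in_chart c f)"
    using smooth_along_subset[OF atlas f_smooth subset_UNIV, of W] c(1) by (simp add: smooth_along_def)
  have e: "?e b (snd c q) = dir_deriv c f q b" for b q
    by (simp add: dir_deriv_def)
  have span: "span ((\<lambda>b. dir_deriv c f q b) ` Basis) = TM q" if "q \<in> fst c" for q
    using linear_span_image[OF linear_df[OF c(1) that], of Basis]
    by (simp add: TM_eq[OF c(1) that])
  have "\<exists>N. open N \<and> snd c p \<in> N \<and> N \<subseteq> ?S \<and> (\<forall>x\<in>N. dim ((\<lambda>b. ?e b x) ` Basis) = card (Basis :: (real ^ 'm) set)) \<and>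
    (\<forall>T w. open T \<longrightarrow> T \<subseteq> N \<longrightarrow> smooth_on T w \<longrightarrow>
      (\<exists>z. smooth_on T z \<and> (\<forall>x\<in>T. w x - z x \<in> span ((\<lambda>b. ?e b x) ` Basis) \<and>
        (\<forall>v\<in>span ((\<lambda>b. ?e b x) ` Basis). ?B x (z x) v = 0))))"
  proof (rule local_orthogonal_complement[OF S])
    show "bilinear (?B x)" for x
      by (rule bilinear_wmetric)
    show "smooth_on T (\<lambda>x. ?B x (u x) (v x))" if "open T" "T \<subseteq> ?S" "smooth_on T u" "smooth_on T v" for T u v
      by (rule smooth_on_wmetric[OF rho_smooth that(1) smooth_on_subset[OF F that(2)] that(3,4)])
    show "smooth_on ?S (?e b)" for b
      by (rule smooth_on_frechet_derivative[OF F])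
    show "dim ((\<lambda>b. ?e b (snd c p)) ` Basis) = card (Basis :: (real ^ 'm) set)"
      using dim_span[of "(\<lambda>b. dir_deriv c f p b) ` Basis"] dim_TM[of p]
      unfolding e span[OF c(2)] by simp
    show "?B (snd c p) v v \<noteq> 0" if "v \<in> span ((\<lambda>b. ?e b (snd c p)) ` Basis)" "v \<noteq> 0" for v
      using that TM_positive[of v p] unfolding e span[OF c(2)] in_chart_apply[OF atlas c(1,2)] by simp
  qed simp
  then obtain N where N: "open N" "snd c p \<in> N" "N \<subseteq> ?S"
    and NT: "\<forall>T w. open T \<longrightarrow> T \<subseteq> N \<longrightarrow> smooth_on T w \<longrightarrow>
      (\<exists>z. smooth_on T z \<and> (\<forall>x\<in>T. w x - z x \<in> span ((\<lambda>b. ?e b x) ` Basis) \<and>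
        (\<forall>v\<in>span ((\<lambda>b. ?e b x) ` Basis). ?B x (z x) v = 0)))"
    by auto
  have "smooth_on N (in_chart c w)"
    using w(1) c(1) by (intro smooth_on_subset[OF _ N(3)]) (simp add: smooth_along_def)
  from NT[rule_format, OF N(1) order_refl this]
  obtain z where z: "smooth_on N z" "\<And>x. x \<in> N \<Longrightarrow> in_chart c w x - z x \<in> span ((\<lambda>b. ?e b x) ` Basis)"
      "\<And>x v. x \<in> N \<Longrightarrow> v \<in> span ((\<lambda>b. ?e b x) ` Basis) \<Longrightarrow> ?B x (z x) v = 0"
    by metis
  have "z (snd c q) \<in> NM q \<and> w q - z (snd c q) \<in> TM q" if q: "q \<in> fst c" "snd c q \<in> N" for q
  proof -
    obtain q' where q': "snd c q = snd c q'" "q' \<in> fst c" "q' \<in> W"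
      using q(2) N(3) by auto
    then have "q \<in> W"
      using chart_inverse[OF atlas c(1) q(1)] chart_inverse[OF atlas c(1) q'(2)] by metis
    have 1: "w q - z (snd c q) \<in> TM q"
      using z(2)[OF q(2)] unfolding e span[OF q(1)] in_chart_apply[OF atlas c(1) q(1)] .
    \<comment> \<open>The Gram-Schmidt result gives only orthogonality to \<open>TM q\<close>.
      Tangency to the warped product follows because \<open>w q\<close> and its tangential component
      are tangent to it.\<close>
    have "w q - (w q - z (snd c q)) \<in> wtangent \<epsilon> (f q)"
      by (rule subspace_diff[OF subspace_wtangent w(2)[OF \<open>q \<in> W\<close>] subsetD[OF TM_wtangent 1]])
    then have "z (snd c q) \<in> wtangent \<epsilon> (f q)"
      by simp
    moreover have "wmetric \<epsilon> \<rho> (f q) (z (snd c q)) v = 0" if "v \<in> TM q" for v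
      using z(3)[OF q(2), of v] that unfolding e span[OF q(1)] in_chart_apply[OF atlas c(1) q(1)] .
    ultimately show ?thesis
      using 1 by (simp add: normal_space_def)
  qed
  with N z(1) show ?thesis
    by (intro exI[of _ N] exI[of _ z]) simp
qed

text \<open>By uniqueness the local projections of \<open>local_normal_part\<close> all agree with
  \<open>normal_part\<close>, so they glue to a smooth field.\<close>

lemma normal_part_section:
  assumes W: "open W" and w: "smooth_along A W w" "\<And>q. q \<in> W \<Longrightarrow> w q \<in> wtangent \<epsilon> (f q)"
  shows "smooth_along A W (\<lambda>q. nor q (w q))"
    and "\<And>p. p \<in> W \<Longrightarrow> nor p (w p) \<in> NM p"
    and "\<And>p. p \<in> W \<Longrightarrow> w p - nor p (w p) \<in> TM p"
proof -
  have "nor p (w p) \<in> NM p \<and> w p - nor p (w p) \<in> TM p" if "p \<in> W" for p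
  proof -
    obtain c where c: "c \<in> A" "p \<in> fst c"
      using chart_exists[OF atlas] by metis
    from local_normal_part[OF c that W w] obtain z where "z \<in> NM p" "w p - z \<in> TM p"
      using c(2) by metis
    then show ?thesis
      using normal_part_eqI by metis
  qed
  then show "\<And>p. p \<in> W \<Longrightarrow> nor p (w p) \<in> NM p" "\<And>p. p \<in> W \<Longrightarrow> w p - nor p (w p) \<in> TM p"
    by auto
  show "smooth_along A W (\<lambda>q. nor q (w q))"
    unfolding smooth_along_def
  proof
    fix c
    assume c: "c \<in> A"
    show "smooth_on (snd c ` (fst c \<inter> W)) (in_chart c (\<lambda>q. nor q (w q)))"
    proof (rule smooth_on_local)
      fix x
      assume "x \<in> snd c ` (fst c \<inter> W)"
      then obtain p where p: "x = snd c p" "p \<in> fst c" "p \<in> W"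
        by auto
      from local_normal_part[OF c p(2,3) W w] obtain T z where
        T: "open T" "x \<in> T" "T \<subseteq> snd c ` (fst c \<inter> W)" "smooth_on T z"
        and z: "\<And>q. q \<in> fst c \<Longrightarrow> snd c q \<in> T \<Longrightarrow> z (snd c q) \<in> NM q \<and> w q - z (snd c q) \<in> TM q"
        unfolding p(1) by metis
      have "z y = in_chart c (\<lambda>q. nor q (w q)) y" if y: "y \<in> T" for y
      proof -
        obtain q where q: "y = snd c q" "q \<in> fst c"
          using y T(3) by auto
        then show ?thesis
          using z[OF q(2)] y normal_part_eqI[of "z y" q "w q"] by (simp add: in_chart_apply[OF atlas c])
      qed
      then have "smooth_on T (in_chart c (\<lambda>q. nor q (w q)))"
        by (rule iffD1[OF smooth_on_cong[OF T(1)] T(4)])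
      with T(1,2) show "\<exists>T. x \<in> T \<and> open T \<and> smooth_on T (in_chart c (\<lambda>q. nor q (w q)))"
        by auto
    qed
  qed
qed

text \<open>For a normal field this is the Weingarten formula: up to a tangent vector, the covariant
  derivative is the normal connection.\<close>

lemma cov_deriv_normal_part:
  assumes c: "c \<in> A" "p \<in> fst c" "p \<in> W" and W: "open W"
    and \<xi>: "smooth_along A W \<xi>" "\<And>q. q \<in> W \<Longrightarrow> \<xi> q \<in> wtangent \<epsilon> (f q)"
  shows "cov c \<xi> p u - nor p (cov c \<xi> p u) \<in> TM p"
  using normal_part_section(3)[of "fst c \<inter> W", OF _ smooth_along_cov_deriv[OF c(1) W \<xi>(1), of u], of p]
    cov_deriv_wtangent[OF c(1) _ _ W \<xi>] open_chart[OF atlas c(1)] W c by auto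

lemma df_section:
  assumes "c \<in> A"
  shows "smooth_along A (fst c) (\<lambda>q. dir_deriv c f q v)"
    and "\<And>q. q \<in> fst c \<Longrightarrow> dir_deriv c f q v \<in> wtangent \<epsilon> (f q)"
  using smooth_along_dir_deriv[OF assms open_UNIV f_smooth] eform_f_df[OF assms]
  by (simp_all add: wtangent_def)

text \<open>The third claim is the Gauss formula. The first two make the second fundamental form of
  constant coordinate fields a normal section, to which the hypothesis on the normal connection can
  be applied.\<close>

lemma second_ff_section:
  assumes c: "c \<in> A"
  shows "smooth_along A (fst c) (\<lambda>q. sff c q u v)"
    and "\<And>q. q \<in> fst c \<Longrightarrow> sff c q u v \<in> NM q"
    and "\<And>q. q \<in> fst c \<Longrightarrow> cov c (\<lambda>q. dir_deriv c f q v) q u - sff c q u v \<in> TM q"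
proof -
  note o = open_chart[OF atlas c]
  have "smooth_along A (fst c) (\<lambda>q. cov c (\<lambda>q. dir_deriv c f q v) q u)"
    using smooth_along_cov_deriv[OF c o df_section(1)[OF c]] by simp
  note ns = normal_part_section[where W = "fst c", OF o this]
  have t: "cov c (\<lambda>q. dir_deriv c f q v) q u \<in> wtangent \<epsilon> (f q)" if "q \<in> fst c" for q
    by (rule cov_deriv_wtangent[OF c that that o df_section[OF c]])
  show "smooth_along A (fst c) (\<lambda>q. sff c q u v)"
    unfolding second_ff_def by (rule ns(1)) (rule t)
  show "sff c q u v \<in> NM q" if "q \<in> fst c" for q
    unfolding second_ff_def by (rule ns(2)) (use t that in auto)
  show "cov c (\<lambda>q. dir_deriv c f q v) q u - sff c q u v \<in> TM q" if "q \<in> fst c" for q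
    unfolding second_ff_def by (rule ns(3)) (use t that in auto)
qed

text \<open>The constant field \<open>(1, 0)\<close> is smooth and tangent to the warped product, so
  it has a normal part; the remainder is the image of \<open>T\<close>.\<close>

lemma eta_normal: "eta \<epsilon> \<rho> A f p \<in> NM p" "(1, 0) - eta \<epsilon> \<rho> A f p \<in> TM p"
proof -
  have s: "smooth_along A UNIV (\<lambda>q. (1, 0) :: 'n ambient)"
    using open_chart_image[OF atlas _ open_UNIV]
    by (auto simp: smooth_along_def in_chart_def comp_def intro!: smooth_on_const)
  have t: "(1, 0) \<in> wtangent \<epsilon> (f q)" for q
    by (simp add: wtangent_def eform_def)
  note ns = normal_part_section(2,3)[OF open_UNIV s t UNIV_I, of p]
  show "eta \<epsilon> \<rho> A f p \<in> NM p"
    unfolding eta_def by (rule ns(1))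
  show "(1, 0) - eta \<epsilon> \<rho> A f p \<in> TM p"
    unfolding eta_def by (rule ns(2))
qed

lemma first_normal_NM: "first_normal \<epsilon> \<rho> A f p \<subseteq> NM p"
  unfolding first_normal_def
  by (rule span_minimal[OF _ subspace_NM]) (use second_ff_section(2) in blast)

end

section \<open>The bundle \<open>P\<close> and the subspaces \<open>V\<close>\<close>

lemma subset_sums:
  fixes S T :: "'a::monoid_add set"
  shows "0 \<in> T \<Longrightarrow> S \<subseteq> {v + w |v w. v \<in> S \<and> w \<in> T}"
    and "0 \<in> S \<Longrightarrow> T \<subseteq> {v + w |v w. v \<in> S \<and> w \<in> T}"
  by (intro subsetI CollectI; metis add_0_right add_0_left)+

locale parallel_first_normal = warped_immersion A g f \<epsilon> \<rho>
  for A :: "('a::topological_space, 'm::finite) chart set"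
    and g and f :: "'a \<Rightarrow> 'n::finite ambient" and \<epsilon> \<rho> +
  fixes L :: "'a \<Rightarrow> 'n ambient set" and l :: nat
  assumes L_eq: "\<And>p. L p = {\<xi> + \<zeta> |\<xi> \<zeta>. \<xi> \<in> first_normal \<epsilon> \<rho> A f p \<and> \<zeta> \<in> span {eta \<epsilon> \<rho> A f p}}"
    and dim_L: "\<And>p. dim (L p) = l"
    and parallel: "normal_conn_maps_into \<epsilon> \<rho> A f (first_normal \<epsilon> \<rho> A f) L"
begin

definition P where "P p = {v + w |v w. v \<in> TM p \<and> w \<in> L p}"

definition V where "V p = span (insert (snd (f p)) (snd ` P p))"

lemma subspace_L: "subspace (L p)"
  unfolding L_eq first_normal_def by (rule subspace_sums[OF subspace_span subspace_span])

lemma first_normal_L: "first_normal \<epsilon> \<rho> A f p \<subseteq> L p"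
  unfolding L_eq by (rule subset_sums(1)[OF span_zero])

lemma L_NM: "L p \<subseteq> NM p"
proof -
  have "span {eta \<epsilon> \<rho> A f p} \<subseteq> NM p"
    by (rule span_minimal[OF _ subspace_NM]) (simp add: eta_normal)
  then show ?thesis
    unfolding L_eq using first_normal_NM subspace_add[OF subspace_NM] by blast
qed

lemma subspace_P: "subspace (P p)"
  unfolding P_def by (rule subspace_sums[OF subspace_TM subspace_L])

lemma TM_P: "TM p \<subseteq> P p"
  unfolding P_def by (rule subset_sums(1)[OF subspace_0[OF subspace_L]])

lemma L_P: "L p \<subseteq> P p"
  unfolding P_def by (rule subset_sums(2)[OF subspace_0[OF subspace_TM]])

lemma P_wtangent: "P p \<subseteq> wtangent \<epsilon> (f p)"
  using TM_wtangent[of p] L_NM[of p] subspace_add[OF subspace_wtangent]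
  unfolding P_def normal_space_def by blast

lemma dt_P: "(1, 0) \<in> P p"
proof -
  have "eta \<epsilon> \<rho> A f p \<in> L p"
    unfolding L_eq first_normal_def using subset_sums(2)[OF span_zero] span_superset by blast
  then have "((1, 0) - eta \<epsilon> \<rho> A f p) + eta \<epsilon> \<rho> A f p \<in> P p"
    unfolding P_def using eta_normal(2) by blast
  then show ?thesis
    by simp
qed

lemma dim_P: "dim (P p) = CARD('m) + l"
proof -
  have "TM p \<inter> L p = {0}"
    using TM_inter_NM[of p] L_NM[of p] subspace_0[OF subspace_TM] subspace_0[OF subspace_L] by blast
  then show ?thesis
    using dim_sums_Int[OF subspace_TM[of p] subspace_L[of p]] by (simp add: P_def dim_TM dim_L)
qed

text \<open>The product \<open>UNIV \<times> V p\<close> is spanned by \<open>P p\<close> and the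
  position vector, since \<open>P p\<close> contains \<open>(1, 0)\<close>, which frees the first
  coordinate. The position vector is not tangent to the warped product, so this space has dimension
  \<open>CARD('m) + l + 1\<close>, and the factor \<open>UNIV\<close> accounts for one.\<close>

lemma dim_V: "dim (V p) = CARD('m) + l"
proof -
  let ?x = "(0, snd (f p)) :: 'n ambient"
  have x: "?x \<notin> span (P p)"
  proof
    assume "?x \<in> span (P p)"
    then have "?x \<in> wtangent \<epsilon> (f p)"
      using P_wtangent subspace_P by (metis span_eq_iff subsetD)
    then show False
      using eps eform_f[of p] by (auto simp: wtangent_def)
  qed
  have "span (insert ?x (P p)) = UNIV \<times> V p"
  proof
    have "snd w \<in> V p" if "w \<in> insert ?x (P p)" for w
      unfolding V_def using that by (intro span_base) auto
    then have "insert ?x (P p) \<subseteq> UNIV \<times> V p"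
      by (intro subsetI) (simp only: mem_Times_iff UNIV_I simp_thms)
    then show "span (insert ?x (P p)) \<subseteq> UNIV \<times> V p"
      by (rule span_minimal) (simp add: V_def subspace_Times)
    have *: "(0, y) \<in> span (insert ?x (P p))" if y: "y \<in> insert (snd (f p)) (snd ` P p)" for y
    proof (cases "y = snd (f p)")
      case True
      then show ?thesis
        by (simp add: span_base)
    next
      case False
      then obtain w where "w \<in> P p" "y = snd w"
        using y by blast
      \<comment> \<open>Subtracting a multiple of \<open>(1, 0)\<close>, itself in
        \<open>P p\<close>, clears the first component.\<close>
      then have "(0, y) = w - fst w *\<^sub>R (1, 0)"
        by (simp add: prod_eq_iff)
      also have "\<dots> \<in> span (insert ?x (P p))"
        using \<open>w \<in> P p\<close> dt_P by (intro span_diff span_scale span_base) auto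
      finally show ?thesis .
    qed
    have "linear (Pair (0::real) :: real \<times> (real ^ 'n) \<Rightarrow> 'n ambient)"
      by (intro linearI) auto
    then have "Pair (0::real) ` V p = span (Pair 0 ` insert (snd (f p)) (snd ` P p))"
      unfolding V_def by (simp only: linear_span_image)
    also have "\<dots> \<subseteq> span (insert ?x (P p))"
      by (rule span_minimal[OF image_subsetI[OF *] subspace_span])
    finally have V: "(0, y) \<in> span (insert ?x (P p))" if "y \<in> V p" for y
      using that by blast
    show "UNIV \<times> V p \<subseteq> span (insert ?x (P p))"
    proof
      fix w :: "'n ambient"
      assume "w \<in> UNIV \<times> V p"
      then have "snd w \<in> V p"
        by (simp add: mem_Times_iff)
      moreover have "w = (0, snd w) + fst w *\<^sub>R (1, 0)"
        by (simp add: prod_eq_iff)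
      ultimately show "w \<in> span (insert ?x (P p))"
        using V dt_P[of p] by (metis insertI2 span_add span_base span_scale)
    qed
  qed
  then have "dim ((UNIV :: real set) \<times> V p) = dim (insert ?x (P p))"
    by (metis dim_span)
  moreover have "dim ((UNIV :: real set) \<times> V p) = 1 + dim (V p)"
    using dim_Times[of "UNIV :: real set" "V p"] by (simp add: V_def subspace_span)
  ultimately show ?thesis
    using x by (simp add: dim_insert dim_P)
qed

section \<open>Fields that span \<open>V\<close> and have flat derivatives in
  \<open>V\<close>\<close>

lemma snd_P_V: "w \<in> P p \<Longrightarrow> snd w \<in> V p"
  unfolding V_def by (intro span_base) auto

lemma f_V: "snd (f p) \<in> V p"
  unfolding V_def by (intro span_base) auto

lemma df_P: "c \<in> A \<Longrightarrow> p \<in> fst c \<Longrightarrow> dir_deriv c f p u \<in> P p"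
  using TM_P TM_eq by blast

text \<open>This is the generating set in the hypothesis of \<open>parallel_constant\<close>, named
  so that each kind of generator can be treated on its own.\<close>

definition parallel_values where
  "parallel_values p = {s p |s W. open W \<and> p \<in> W \<and> smooth_along A W s \<and>
      (\<forall>q\<in>W. s q \<in> V q) \<and> (\<forall>c\<in>A. \<forall>q\<in>fst c \<inter> W. \<forall>u. dir_deriv c s q u \<in> V q)}"

lemma smooth_along_snd:
  assumes "open W" "smooth_along A W \<xi>"
  shows "smooth_along A W (\<lambda>q. snd (\<xi> q))"
  unfolding smooth_along_def
proof
  fix c
  assume c: "c \<in> A"
  have "in_chart c (\<lambda>q. snd (\<xi> q)) = (\<lambda>x. snd (in_chart c \<xi> x))"
    by (simp add: in_chart_def comp_def)
  moreover have "smooth_on (snd c ` (fst c \<inter> W)) (in_chart c \<xi>)"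
    using assms(2) c by (simp add: smooth_along_def)
  ultimately show "smooth_on (snd c ` (fst c \<inter> W)) (in_chart c (\<lambda>q. snd (\<xi> q)))"
    using smooth_on_snd[OF open_chart_image[OF atlas c assms(1)]] by simp
qed

lemma dir_deriv_snd:
  assumes "c \<in> A" "p \<in> fst c" "p \<in> W" "smooth_along A W \<xi>"
  shows "dir_deriv c (\<lambda>q. snd (\<xi> q)) p u = snd (dir_deriv c \<xi> p u)"
proof -
  have "((\<lambda>x. snd (in_chart c \<xi> x)) has_derivative (\<lambda>u. snd (dir_deriv c \<xi> p u))) (at (snd c p))"
    by (rule bounded_linear.has_derivative[OF bounded_linear_snd
          smooth_along_has_derivative[OF atlas assms(4,1,2,3)]])
  moreover have "in_chart c (\<lambda>q. snd (\<xi> q)) = (\<lambda>x. snd (in_chart c \<xi> x))"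
    by (simp add: in_chart_def comp_def)
  ultimately show ?thesis
    by (simp add: dir_deriv_def frechet_derivative_at[symmetric])
qed

lemma parallel_values_f: "snd (f p) \<in> parallel_values p"
proof -
  have "dir_deriv c (\<lambda>q. snd (f q)) q u \<in> V q" if "c \<in> A" "q \<in> fst c" for c q u
    using dir_deriv_snd[OF that UNIV_I f_smooth] snd_P_V[OF df_P[OF that]] by simp
  then show ?thesis
    unfolding parallel_values_def using smooth_along_snd[OF open_UNIV f_smooth] f_V
    by (intro CollectI exI[of _ "\<lambda>q. snd (f q)"] exI[of _ UNIV]) simp
qed

text \<open>The flat derivative differs from the covariant one by the Christoffel term. The second
  component of that term is a combination of the second components of \<open>\<xi>\<close>, of the
  derivative of \<open>f\<close> and of the position vector, all of which lie in
  \<open>V\<close>.\<close>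

lemma parallel_values_section:
  assumes c: "c \<in> A" "p \<in> fst c"
    and \<xi>: "smooth_along A (fst c) \<xi>" "\<And>q. q \<in> fst c \<Longrightarrow> \<xi> q \<in> P q"
      "\<And>q u. q \<in> fst c \<Longrightarrow> cov c \<xi> q u \<in> P q"
  shows "snd (\<xi> p) \<in> parallel_values p"
proof -
  note s = smooth_along_snd[OF open_chart[OF atlas c(1)] \<xi>(1)]
  have 1: "dir_deriv c (\<lambda>q. snd (\<xi> q)) q u \<in> V q" if q: "q \<in> fst c" for q u
  proof -
    have V: "subspace (V q)"
      by (simp add: V_def)
    note sV = snd_P_V[OF \<xi>(2)[OF q]] snd_P_V[OF df_P[OF c(1) q]] snd_P_V[OF \<xi>(3)[OF q]] f_V
    have "snd (wchristoffel \<epsilon> \<rho> (f q) (dir_deriv c f q u) (\<xi> q)) \<in> V q"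
      unfolding wchristoffel_def snd_conv by (intro subspace_add[OF V] subspace_scale[OF V] sV)
    moreover have "snd (dir_deriv c \<xi> q u) =
        snd (cov c \<xi> q u) - snd (wchristoffel \<epsilon> \<rho> (f q) (dir_deriv c f q u) (\<xi> q))"
      by (simp add: cov_deriv_def)
    ultimately show ?thesis
      using dir_deriv_snd[OF c(1) q q \<xi>(1)] subspace_diff[OF V sV(3)] by metis
  qed
  \<comment> \<open>In another chart the chain rule only changes the direction, and the claim holds
    for all directions.\<close>
  have "dir_deriv c' (\<lambda>q. snd (\<xi> q)) q u \<in> V q" if "c' \<in> A" "q \<in> fst c' \<inter> fst c" for c' q u
    using dir_deriv_chain[OF atlas s _ that(1) c(1)] that(2) 1 by simp
  moreover have "\<forall>q\<in>fst c. snd (\<xi> q) \<in> V q"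
    using snd_P_V \<xi>(2) by metis
  ultimately show ?thesis
    unfolding parallel_values_def using s c(2) open_chart[OF atlas c(1)]
    by (intro CollectI exI[of _ "\<lambda>q. snd (\<xi> q)"] exI[of _ "fst c"]) simp
qed

text \<open>By the Gauss formula the covariant derivative lies in \<open>TM\<close> plus the first
  normal space, hence in \<open>P\<close>.\<close>

lemma parallel_values_df:
  assumes "c \<in> A" "p \<in> fst c"
  shows "snd (dir_deriv c f p v) \<in> parallel_values p"
proof (rule parallel_values_section[OF assms df_section(1)[OF assms(1)] df_P[OF assms(1)]])
  fix q u
  assume q: "q \<in> fst c"
  have "sff c q u v \<in> first_normal \<epsilon> \<rho> A f q"
    unfolding first_normal_def using assms(1) q by (intro span_base) blast
  then have "(cov c (\<lambda>q. dir_deriv c f q v) q u - sff c q u v) + sff c q u v \<in> P q"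
    unfolding P_def using second_ff_section(3)[OF assms(1) q] first_normal_L by blast
  then show "cov c (\<lambda>q. dir_deriv c f q v) q u \<in> P q"
    by simp
qed

text \<open>The second fundamental form is a section of the first normal space over the chart
  domain. The hypothesis \<open>parallel\<close> puts its normal derivative in \<open>L\<close>, and
  the tangential remainder lies in \<open>TM\<close>.\<close>

lemma parallel_values_second_ff:
  assumes c: "c \<in> A" "p \<in> fst c"
  shows "snd (sff c p v w) \<in> parallel_values p"
proof (rule parallel_values_section[OF c second_ff_section(1)[OF c(1)]])
  have N1: "sff c q v w \<in> first_normal \<epsilon> \<rho> A f q" if "q \<in> fst c" for q
    unfolding first_normal_def using c(1) that by (intro span_base) blast
  then show "sff c q v w \<in> P q" if "q \<in> fst c" for q
    using that first_normal_L L_P by blast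
  fix q u
  assume q: "q \<in> fst c"
  have "normal_section \<epsilon> \<rho> A f (fst c) (\<lambda>q. sff c q v w)"
    unfolding normal_section_def
    using open_chart[OF atlas c(1)] second_ff_section(1,2)[OF c(1)] by simp
  then have "normal_conn \<epsilon> \<rho> A c f (\<lambda>q. sff c q v w) q u \<in> L q"
    using parallel[unfolded normal_conn_maps_into_def, rule_format, of "fst c" "\<lambda>q. sff c q v w" c q u]
      N1 c(1) q by simp
  moreover have "sff c q v w \<in> wtangent \<epsilon> (f q)" if "q \<in> fst c" for q
    using second_ff_section(2)[OF c(1) that] by (simp add: normal_space_def)
  note cov_deriv_normal_part[OF c(1) q q open_chart[OF atlas c(1)] second_ff_section(1)[OF c(1)] this, of u]
  ultimately have "(cov c (\<lambda>q. sff c q v w) q u - normal_conn \<epsilon> \<rho> A c f (\<lambda>q. sff c q v w) q u)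
      + normal_conn \<epsilon> \<rho> A c f (\<lambda>q. sff c q v w) q u \<in> P q"
    unfolding P_def normal_conn_def by blast
  then show "cov c (\<lambda>q. sff c q v w) q u \<in> P q"
    by simp
qed

lemma V_parallel_values: "V p \<subseteq> span (parallel_values p)"
proof -
  let ?S = "span (parallel_values p)"
  have lin: "linear (snd :: 'n ambient \<Rightarrow> _)"
    by (rule bounded_linear.linear[OF bounded_linear_snd])
  have TM: "snd v \<in> ?S" if "v \<in> TM p" for v
    using that parallel_values_df by (auto simp: tangent_image_def intro: span_base)
  have "{sff c p u v |c u v. c \<in> A \<and> p \<in> fst c} \<subseteq> snd -` ?S"
    using span_base[OF parallel_values_second_ff] by blast
  then have "first_normal \<epsilon> \<rho> A f p \<subseteq> snd -` ?S"
    unfolding first_normal_def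
    by (rule span_minimal[OF _ linear_subspace_vimage[OF lin subspace_span]])
  moreover have "span {eta \<epsilon> \<rho> A f p} \<subseteq> snd -` ?S"
  proof (rule span_minimal[OF _ linear_subspace_vimage[OF lin subspace_span]])
    \<comment> \<open>Since \<open>(1, 0)\<close> has second component zero, \<open>eta\<close>
      projects to minus the projection of a vector of \<open>TM p\<close>, which is already
      covered.\<close>
    have "snd ((1, 0) - eta \<epsilon> \<rho> A f p) \<in> ?S"
      by (rule TM[OF eta_normal(2)])
    from span_neg[OF this] show "{eta \<epsilon> \<rho> A f p} \<subseteq> snd -` ?S"
      by simp
  qed
  ultimately have L: "L p \<subseteq> snd -` ?S"
    unfolding L_eq[of p]
    using subspace_add[OF linear_subspace_vimage[OF lin subspace_span], of _ "parallel_values p"] by blast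
  have "P p \<subseteq> snd -` ?S"
    unfolding P_def
    using TM L subspace_add[OF linear_subspace_vimage[OF lin subspace_span], of _ "parallel_values p"] by blast
  then have "insert (snd (f p)) (snd ` P p) \<subseteq> ?S"
    using span_base[OF parallel_values_f] by blast
  then show ?thesis
    unfolding V_def by (rule span_minimal[OF _ subspace_span])
qed

section \<open>Constancy of \<open>V\<close> and reduction of codimension\<close>

lemma V_constant: "connected (UNIV :: 'a set) \<Longrightarrow> V p = V q"
  by (rule parallel_constant[OF atlas _ _ dim_V V_parallel_values[unfolded parallel_values_def]])
    (simp_all add: V_def)

lemma reduction_of_codimension:
  assumes "connected (UNIV :: 'a set)"
  shows "\<exists>S. totally_geodesic_Q \<epsilon> (CARD('m) + l - 1) S \<and> range f \<subseteq> UNIV \<times> S"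
proof -
  \<comment> \<open>Any base point will do, as the type of points is inhabited; \<open>V p\<close>
    is the common value of the family.\<close>
  fix p
  have "snd (f q) \<in> Q \<epsilon> \<inter> V p" for q
    using immersion f_V[of q] V_constant[OF assms, of q p]
    by (auto simp: isometric_immersion_def image_subset_iff mem_Times_iff)
  then have "range f \<subseteq> UNIV \<times> (Q \<epsilon> \<inter> V p)" "Q \<epsilon> \<inter> V p \<noteq> {}"
    by (auto simp: image_subset_iff mem_Times_iff)
  \<comment> \<open>The truncated subtraction is harmless because \<open>CARD('m)\<close> is
    positive.\<close>
  moreover have "dim (V p) = (CARD('m) + l - 1) + 1"
    by (simp add: dim_V Suc_leI)
  moreover have "subspace (V p)"
    by (simp add: V_def)
  ultimately show ?thesis
    unfolding totally_geodesic_Q_def by metis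
qed

end

theorem lemma3p1:
  fixes A :: "('a::{t2_space, second_countable_topology}, 'm::finite) chart set"
    and g :: "('a, 'm) chart \<Rightarrow> 'a \<Rightarrow> real ^ 'm \<Rightarrow> real ^ 'm \<Rightarrow> real"
    and f :: "'a \<Rightarrow> 'n::finite ambient"
    and \<epsilon> :: real and \<rho> h :: "real \<Rightarrow> real" and l :: nat
    and L :: "'a \<Rightarrow> 'n ambient set"
  assumes eps: "\<epsilon> = 1 \<or> \<epsilon> = -1"
    and rho: "smooth_on UNIV \<rho>" "\<forall>t. \<rho> t > 0"
    and rotational: "smooth_on UNIV h" "\<forall>t. \<epsilon> * (deriv \<rho> t)\<^sup>2 + (deriv h t)\<^sup>2 = 1"
      "\<forall>t. deriv h t > 0"
    and nonconst_curv:
      "\<forall>t. (deriv (deriv \<rho>) t * \<rho> t - (deriv \<rho> t)\<^sup>2 + \<epsilon>) / (\<rho> t)\<^sup>2 \<noteq> 0"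
    and M: "smooth_atlas A" "riemannian_metric A g" "connected (UNIV :: 'a set)"
    and f: "isometric_immersion \<epsilon> \<rho> A g f"
    and L_def: "\<forall>p. L p = {\<xi> + \<zeta> | \<xi> \<zeta>. \<xi> \<in> first_normal \<epsilon> \<rho> A f p \<and> \<zeta> \<in> span {eta \<epsilon> \<rho> A f p}}"
    and L_subbundle: "normal_subbundle \<epsilon> \<rho> A f L l"
    and rank: "l + CARD('m) < CARD('n) + 1"
    and parallel: "normal_conn_maps_into \<epsilon> \<rho> A f (first_normal \<epsilon> \<rho> A f) L"
  shows "\<exists>S. totally_geodesic_Q \<epsilon> (CARD('m) + l - 1) S \<and> range f \<subseteq> UNIV \<times> S"
proof -
  interpret parallel_first_normal A g f \<epsilon> \<rho> L l
  proof
    show "dim (L p) = l" for p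
      using L_subbundle unfolding normal_subbundle_def by metis
  qed (use assms in auto)
  show ?thesis
    by (rule reduction_of_codimension[OF M(3)])
qed

end
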